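(* Let $n \geq 1$, let $M^n$ be a closed, convex hypersurface in $\mathbb{R}^{n+1}$, and let $\rho > 1$. Suppose there exist distinct $x,y \in M$ such that $\frac{d_M(x,y)}{|y-x|} \geq \rho$ and, also, that the hyperplanes $\ell_{xy}^\perp$ and $\ell_{yx}^\perp$ in $\mathbb{R}^{n+1}$ orthogonal to the line $\ell_{xy}$ through $x$ and $y$, passing through $x$ and $y$ respectively, are support planes for $M$. Let $\mathcal{I}^*_n(\rho) = \frac{\omega_n}{2^{n-1}} \left( \frac{\rho - 1}{\rho} \right)^n$, where $\omega_n$ is the volume of the unit $n$-ball. Then $$\mathrm{Area}(M) > \mathcal{I}_n^*(\rho)\, d_M(x,y)^n.$$
   Context: A closed, convex hypersurface $M^n$ in $\mathbb{R}^{n+1}$ is the boundary of a compact convex set with nonempty interior in $\mathbb{R}^{n+1}$; no smoothness is assumed. $\mathrm{Area}(M)$ is the $n$-dimensional Hausdorff measure of $M$. The intrinsic distance $d_M(x,y)$ is the minimal length of a path contained in $M$ connecting $x$ and $y$, and $|y-x|$ is the Euclidean distance. *)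

theory Defs
  imports "HOL-Analysis.Analysis"
begin

definition closed_convex_hypersurface :: "'a::euclidean_space set \<Rightarrow> bool" where
  "closed_convex_hypersurface M \<longleftrightarrow>
     (\<exists>K. compact K \<and> convex K \<and> interior K \<noteq> {} \<and> M = frontier K)"

(* Hausdorff measure in the standard normalization: a set of diameter d contributes
   \<omega>_n (d/2)^n, so that on R^n the measure agrees with Lebesgue measure.
   Boundedness is required because diameter is an unspecified real on unbounded sets;
   the empty set is given weight 0 explicitly since 0^0 = 1 (relevant for n = 0 only). *)

definition hausdorff_weight :: "nat \<Rightarrow> 'a::metric_space set \<Rightarrow> ennreal" where
  "hausdorff_weight n C =
     (if C = {} then 0 else ennreal (unit_ball_vol (real n) * (diameter C / 2) ^ n))"

definition hausdorff_premeasure :: "nat \<Rightarrow> real \<Rightarrow> 'a::metric_space set \<Rightarrow> ennreal" where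
  "hausdorff_premeasure n \<delta> A =
     (INF C \<in> {C :: nat \<Rightarrow> 'a set. A \<subseteq> (\<Union>i. C i) \<and> (\<forall>i. bounded (C i) \<and> diameter (C i) \<le> \<delta>)}.
        \<Sum>i. hausdorff_weight n (C i))"

definition hausdorff_measure :: "nat \<Rightarrow> 'a::metric_space set \<Rightarrow> ennreal" where
  "hausdorff_measure n A = (SUP \<delta> \<in> {0<..}. hausdorff_premeasure n \<delta> A)"

(* t 0 \<le> ... \<le> t k is an arbitrary finite partition; its values beyond k are irrelevant. *)

definition path_length :: "(real \<Rightarrow> 'a::metric_space) \<Rightarrow> ennreal" where
  "path_length g =
     (SUP (k, t) \<in> {(k :: nat, t :: nat \<Rightarrow> real). mono t \<and> range t \<subseteq> {0..1}}.
        \<Sum>i<k. ennreal (dist (g (t i)) (g (t (Suc i)))))"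

(* The value is \<infinity> if no path of finite length in M joins x to y.  When the infimum over paths
   in a compact set M is finite, it is a minimum. *)

definition intrinsic_dist :: "'a::real_normed_vector set \<Rightarrow> 'a \<Rightarrow> 'a \<Rightarrow> ennreal" where
  "intrinsic_dist M x y =
     (INF g \<in> {g. path g \<and> path_image g \<subseteq> M \<and> pathstart g = x \<and> pathfinish g = y}.
        path_length g)"

definition orth_hyperplane :: "'a::euclidean_space \<Rightarrow> 'a \<Rightarrow> 'a set" where
  "orth_hyperplane x y = {z. (y - x) \<bullet> (z - x) = 0}"

(* Replacing (a, b) by (-a, -b) covers the opposite half-space. *)

definition support_plane :: "'a::euclidean_space set \<Rightarrow> 'a set \<Rightarrow> bool" where
  "support_plane H M \<longleftrightarrow>
     (\<exists>a b. a \<noteq> 0 \<and> H = {z. a \<bullet> z = b} \<and> M \<subseteq> {z. a \<bullet> z \<le> b} \<and> H \<inter> M \<noteq> {})"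

definition I_star :: "nat \<Rightarrow> real \<Rightarrow> real" where
  "I_star n \<rho> = unit_ball_vol (real n) / 2 ^ (n - 1) * ((\<rho> - 1) / \<rho>) ^ n"

end

theory Submission
  imports Defs
begin

text \<open>
  Let \<open>M\<close> bound the convex body \<open>K\<close>, let \<open>e\<close> be the unit vector from \<open>x\<close> to \<open>y\<close>, \<open>h = \<bar>y - x\<bar>\<close> and
  \<open>d = d\<^sub>M(x, y)\<close>. The two support planes confine \<open>K\<close> to the slab \<open>0 \<le> (z - x) \<bullet> e \<le> h\<close>.
  
  \<^emph>\<open>The shadow of \<open>K\<close> is large.\<close> Fix a unit vector \<open>v\<close> orthogonal to \<open>e\<close> and suppose that \<open>K\<close> extends at
  most to distance \<open>r\<close> in the half-plane that the line \<open>xy\<close> and \<open>v\<close> span. The three sides of the rectangle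
  \<open>[0, r] \<times> [0, h]\<close> of that half-plane that lead from \<open>x\<close> to \<open>y\<close> have total length \<open>2 r + h\<close> and avoid the
  interior of \<open>K\<close>. The nearest-point map onto \<open>K\<close> is 1-Lipschitz and sends the complement of the interior
  to \<open>M\<close>, so it turns them into a path in \<open>M\<close> that is no longer; hence \<open>d \<le> 2 r + h\<close>. If a corner
  of the rectangle is missing from \<open>K\<close>, cutting that corner off makes the inequality strict
  (\<open>intrinsic_dist_less_rectangle\<close>). With \<open>R = (d - h) / 2\<close> this says: in every direction \<open>v\<close>, either \<open>K\<close>
  reaches beyond distance \<open>R\<close>, or both corners of the rectangle of width \<open>R\<close> lie in \<open>K\<close>. In
  particular the orthogonal projection of \<open>K\<close> along \<open>e\<close> contains the ball of radius \<open>R\<close> about the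
  projection of \<open>x\<close>.
  
  \<^emph>\<open>Area dominates projected volume.\<close> The upper and the lower sheet of \<open>M\<close> both project onto that ball, which
  gives area at least \<open>2 \<omega>\<^sub>n R\<^sup>n\<close>. As \<open>d \<ge> \<rho> h\<close> implies \<open>R \<ge> d (\<rho> - 1) / (2 \<rho>)\<close>, this is the claimed bound
  up to strictness. The inequality between Hausdorff measure and Lebesgue measure of a projection
  is the isodiametric inequality (\<open>isodiametric\<close>), applied to the members of a covering. The two sheets are
  counted separately because over a slightly smaller ball they have positive distance, so that no
  set of small diameter meets both (\<open>hausdorff_measure_ge_sum_of_shadows\<close>).
  
  \<^emph>\<open>Strictness.\<close> A third piece of \<open>M\<close>, away from the two sheets, contributes an amount that stays fixed while
  the radius of the smaller ball tends to \<open>R\<close>. If \<open>K\<close> reaches beyond \<open>R\<close> in some direction, then its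
  projection contains a further ball outside the ball of radius \<open>R\<close>
  (\<open>hausdorff_measure_gt_if_wide\<close>). Otherwise \<open>K\<close> contains the whole cylinder of radius \<open>R\<close> and height \<open>h\<close>, and
  the middle of its lateral boundary is seen by projecting along a direction orthogonal to \<open>e\<close>
  (\<open>hausdorff_measure_gt_if_cylinder\<close>).
\<close>

section \<open>The isodiametric inequality by Steiner symmetrization\<close>

text \<open>
  The one-dimensional fact behind Steiner symmetrization: of the two spans \<open>Sup X - Inf Y\<close> and
  \<open>Sup Y - Inf X\<close>, both at most \<open>D\<close>, the sum equals the sum of the lengths of the hulls of \<open>X\<close> and \<open>Y\<close>.
\<close>

lemma emeasure_add_le_distance_bound:
  fixes X Y :: "real set"
  assumes ne: "X \<noteq> {}" "Y \<noteq> {}"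
    and D: "\<And>s t. s \<in> X \<Longrightarrow> t \<in> Y \<Longrightarrow> \<bar>s - t\<bar> \<le> D"
  shows "emeasure lborel X + emeasure lborel Y \<le> ennreal (2 * D)"
proof -
  obtain p q where pq: "p \<in> X" "q \<in> Y" using ne by auto
  have bX: "bdd_above X" "bdd_below X"
    using D[OF _ pq(2)] by (force intro!: bdd_aboveI[of _ "q + D"] bdd_belowI[of _ "q - D"] simp: abs_le_iff)+
  have bY: "bdd_above Y" "bdd_below Y"
    using D[OF pq(1)] by (force intro!: bdd_aboveI[of _ "p + D"] bdd_belowI[of _ "p - D"] simp: abs_le_iff)+
  have XI: "X \<subseteq> {Inf X..Sup X}" "Y \<subseteq> {Inf Y..Sup Y}"
    using bX bY by (auto intro: cInf_lower cSup_upper)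
  have "Sup X \<le> D + Inf Y"
  proof (rule cSup_least[OF ne(1)])
    fix s assume "s \<in> X"
    then have "s - D \<le> Inf Y" using D by (intro cInf_greatest[OF ne(2)]) (force simp: abs_le_iff)
    then show "s \<le> D + Inf Y" by simp
  qed
  moreover have "Sup Y \<le> D + Inf X"
  proof (rule cSup_least[OF ne(2)])
    fix s assume "s \<in> Y"
    then have "s - D \<le> Inf X" using D by (intro cInf_greatest[OF ne(1)]) (force simp: abs_le_iff)
    then show "s \<le> D + Inf X" by simp
  qed
  moreover have "Inf X \<le> Sup X" "Inf Y \<le> Sup Y"
    using cInf_le_cSup[OF ne(1) bX] cInf_le_cSup[OF ne(2) bY] .
  moreover have "emeasure lborel X \<le> emeasure lborel {Inf X..Sup X}"
    "emeasure lborel Y \<le> emeasure lborel {Inf Y..Sup Y}"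
    using XI by (auto intro!: emeasure_mono)
  ultimately have "emeasure lborel X + emeasure lborel Y
      \<le> ennreal (Sup X - Inf X) + ennreal (Sup Y - Inf Y)"
    by (intro add_mono) auto
  also have "\<dots> = ennreal ((Sup X - Inf X) + (Sup Y - Inf Y))"
    using \<open>Inf X \<le> Sup X\<close> \<open>Inf Y \<le> Sup Y\<close> by (simp add: ennreal_plus)
  also have "\<dots> \<le> ennreal (2 * D)"
    using \<open>Sup X \<le> D + Inf Y\<close> \<open>Sup Y \<le> D + Inf X\<close> by (intro ennreal_leI) simp
  finally show ?thesis .
qed

lemma emeasure_open_centered_interval:
  fixes m :: ennreal
  shows "emeasure lborel {t::real. ennreal (2 * \<bar>t\<bar>) < m} = m"
proof (cases m)
  case (real r)
  then have "{t::real. ennreal (2 * \<bar>t\<bar>) < m} = {-r/2<..<r/2}"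
    by (auto simp: ennreal_less_iff abs_less_iff)
  then show ?thesis using real by simp
next
  case top
  then show ?thesis by (simp add: ennreal_less_top)
qed

definition fibre_length :: "'i \<Rightarrow> ('i \<Rightarrow> real) set \<Rightarrow> ('i \<Rightarrow> real) \<Rightarrow> ennreal" where
  "fibre_length i A \<phi> = emeasure lborel {t. \<phi>(i := t) \<in> A}"

text \<open>
  The strict inequality makes the symmetrized fibres open intervals. It keeps a fibre of length
  zero empty, so that no point appears over a base point that \<open>A\<close> does not project to; such points could increase the
  diameter.
\<close>

definition steiner :: "'i set \<Rightarrow> 'i \<Rightarrow> ('i \<Rightarrow> real) set \<Rightarrow> ('i \<Rightarrow> real) set" where
  "steiner I i A =
     {\<phi> \<in> space (PiM I (\<lambda>_. lborel)). ennreal (2 * \<bar>\<phi> i\<bar>) < fibre_length i A \<phi>}"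

lemma fibre_length_upd [simp]: "fibre_length i A (\<phi>(i := s)) = fibre_length i A \<phi>"
  by (simp add: fibre_length_def)

lemma measurable_fibre_length:
  assumes "i \<in> I" and [measurable]: "A \<in> sets (PiM I (\<lambda>_. lborel))"
  shows "fibre_length i A \<in> borel_measurable (PiM I (\<lambda>_. lborel))"
proof -
  let ?P = "PiM I (\<lambda>_. lborel :: real measure)"
  have [measurable]: "(\<lambda>p. (fst p)(i := snd p)) \<in> measurable (?P \<Otimes>\<^sub>M lborel) ?P"
    using \<open>i \<in> I\<close>
    by (intro measurable_fun_upd[where J = "I" and I = I]) auto
  let ?Q = "(\<lambda>p. (fst p)(i := snd p)) -` A \<inter> space (?P \<Otimes>\<^sub>M lborel)"
  have "?Q \<in> sets (?P \<Otimes>\<^sub>M lborel)" by measurable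
  from lborel.measurable_emeasure_Pair[OF this]
  show ?thesis
    by (rule measurable_cong[THEN iffD1, rotated]) (auto simp: fibre_length_def space_pair_measure intro!: arg_cong[where f="emeasure lborel"])
qed

lemma sets_steiner:
  assumes "i \<in> I" and A: "A \<in> sets (PiM I (\<lambda>_. lborel))"
  shows "steiner I i A \<in> sets (PiM I (\<lambda>_. lborel))"
proof -
  note [measurable] = measurable_fibre_length[OF assms]
  have [measurable]: "(\<lambda>\<phi>. \<phi> i) \<in> borel_measurable (PiM I (\<lambda>_. lborel :: real measure))"
    using measurable_component_singleton[OF \<open>i \<in> I\<close>, of "\<lambda>_. lborel :: real measure"] by simp
  show ?thesis unfolding steiner_def by measurable
qed

lemma emeasure_eq_nn_integral_fibre_length:
  assumes I: "finite I" "i \<notin> I" and A: "A \<in> sets (PiM (insert i I) (\<lambda>_. lborel))"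
  shows "emeasure (PiM (insert i I) (\<lambda>_. lborel)) A
    = (\<integral>\<^sup>+\<psi>. fibre_length i A \<psi> \<partial>PiM I (\<lambda>_. lborel))"
proof -
  interpret product_sigma_finite "\<lambda>_. lborel :: real measure" by standard
  note [measurable] = A
  have "emeasure (PiM (insert i I) (\<lambda>_. lborel)) A
     = (\<integral>\<^sup>+\<psi>. (\<integral>\<^sup>+t. indicator A (\<psi>(i := t)) \<partial>lborel) \<partial>PiM I (\<lambda>_. lborel))"
    using product_nn_integral_insert[OF I, of "indicator A"] by simp
  also have "\<dots> = (\<integral>\<^sup>+\<psi>. fibre_length i A \<psi> \<partial>PiM I (\<lambda>_. lborel))"
  proof (rule nn_integral_cong)
    fix \<psi> assume psi: "\<psi> \<in> space (PiM I (\<lambda>_. lborel :: real measure))"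
    have [measurable]: "(\<lambda>t. \<psi>(i := t)) \<in> measurable lborel (PiM (insert i I) (\<lambda>_. lborel))"
      using psi by (intro measurable_fun_upd[where J = I]) auto
    have "(\<integral>\<^sup>+t. indicator A (\<psi>(i := t)) \<partial>lborel)
      = (\<integral>\<^sup>+t. indicator ((\<lambda>t. \<psi>(i := t)) -` A \<inter> space lborel) t \<partial>lborel)"
      by (intro nn_integral_cong) (auto simp: indicator_def)
    also have "\<dots> = emeasure lborel ((\<lambda>t. \<psi>(i := t)) -` A \<inter> space lborel)"
      by (rule nn_integral_indicator) measurable
    finally show "(\<integral>\<^sup>+t. indicator A (\<psi>(i := t)) \<partial>lborel) = fibre_length i A \<psi>"
      by (simp add: fibre_length_def vimage_def)
  qed
  finally show ?thesis .
qed

text \<open>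
  Cavalieri's principle: the fibres keep their length.
\<close>

lemma emeasure_steiner:
  assumes "finite I" "i \<in> I" and A: "A \<in> sets (PiM I (\<lambda>_. lborel))"
  shows "emeasure (PiM I (\<lambda>_. lborel)) (steiner I i A) = emeasure (PiM I (\<lambda>_. lborel)) A"
proof -
  define J where "J = I - {i}"
  have J: "finite J" "i \<notin> J" and I: "I = insert i J" using assms by (auto simp: J_def)
  have "fibre_length i (steiner I i A) \<psi> = fibre_length i A \<psi>"
    if "\<psi> \<in> space (PiM J (\<lambda>_. lborel :: real measure))" for \<psi>
  proof -
    have "\<psi>(i := t) \<in> space (PiM I (\<lambda>_. lborel :: real measure))" for t
      using that by (auto simp: I space_PiM PiE_def extensional_def)
    then have "fibre_length i (steiner I i A) \<psi>
        = emeasure lborel {t. ennreal (2 * \<bar>t\<bar>) < fibre_length i A \<psi>}"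
      unfolding fibre_length_def[of i "steiner I i A"] by (simp add: steiner_def)
    then show ?thesis by (simp add: emeasure_open_centered_interval)
  qed
  then show ?thesis
    unfolding I using sets_steiner[OF assms(2,3)] A
    by (subst (1 2) emeasure_eq_nn_integral_fibre_length[OF J]) (auto simp: I intro!: nn_integral_cong)
qed

text \<open>
  Two symmetric intervals of lengths \<open>m\<close> and \<open>m'\<close> contain no points further apart than \<open>(m + m') / 2\<close>, while in
  the original fibres some points are at least that far apart, up to an arbitrarily small error. The other
  coordinates are unchanged, so the diameter does not grow.
\<close>

lemma steiner_sq_dist_le:
  assumes "finite I" "i \<in> I"
    and d: "\<And>\<phi> \<psi>. \<phi> \<in> A \<Longrightarrow> \<psi> \<in> A \<Longrightarrow> (\<Sum>j\<in>I. (\<phi> j - \<psi> j)\<^sup>2) \<le> d\<^sup>2"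
    and phi: "\<phi> \<in> steiner I i A" and psi: "\<psi> \<in> steiner I i A"
  shows "(\<Sum>j\<in>I. (\<phi> j - \<psi> j)\<^sup>2) \<le> d\<^sup>2"
proof -
  define X where "X = {t. \<phi>(i := t) \<in> A}"
  define Y where "Y = {t. \<psi>(i := t) \<in> A}"
  define a where "a = (\<Sum>j\<in>I - {i}. (\<phi> j - \<psi> j)\<^sup>2)"
  define D where "D = sqrt (d\<^sup>2 - a)"
  have lt: "ennreal (2 * \<bar>\<phi> i\<bar>) < emeasure lborel X" "ennreal (2 * \<bar>\<psi> i\<bar>) < emeasure lborel Y"
    using phi psi by (auto simp: steiner_def fibre_length_def X_def Y_def)
  then have ne: "X \<noteq> {}" "Y \<noteq> {}" by auto
  have key: "a + (s - t)\<^sup>2 \<le> d\<^sup>2" if "s \<in> X" "t \<in> Y" for s t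
  proof -
    have "(\<Sum>j\<in>I - {i}. ((\<phi>(i := s)) j - (\<psi>(i := t)) j)\<^sup>2) = a"
      unfolding a_def by (rule sum.cong) auto
    then show ?thesis
      using d[of "\<phi>(i := s)" "\<psi>(i := t)"] that assms(1,2)
      by (auto simp: X_def Y_def sum.remove[of I i] add.commute)
  qed
  have bd: "\<bar>s - t\<bar> \<le> D" if "s \<in> X" "t \<in> Y" for s t
    unfolding D_def using key[OF that] by (intro real_le_rsqrt) auto
  obtain s t where st: "s \<in> X" "t \<in> Y" using ne by auto
  then have "0 \<le> d\<^sup>2 - a" using key[OF st] zero_le_power2[of "s - t"] by linarith
  then have D: "0 \<le> D" "D\<^sup>2 = d\<^sup>2 - a" by (simp_all add: D_def)
  have "ennreal (2 * \<bar>\<phi> i\<bar> + 2 * \<bar>\<psi> i\<bar>) \<le> emeasure lborel X + emeasure lborel Y"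
    using lt by (subst ennreal_plus) (auto intro!: add_mono simp: less_imp_le)
  also have "\<dots> \<le> ennreal (2 * D)"
    by (rule emeasure_add_le_distance_bound[OF ne bd])
  finally have "2 * \<bar>\<phi> i\<bar> + 2 * \<bar>\<psi> i\<bar> \<le> 2 * D"
    using D(1) by (subst (asm) ennreal_le_iff) auto
  then have "\<bar>\<phi> i - \<psi> i\<bar> \<le> D" by linarith
  then have "(\<phi> i - \<psi> i)\<^sup>2 \<le> D\<^sup>2" using D(1) by (simp add: abs_le_square_iff[symmetric])
  then show ?thesis using D(2) assms(1,2) by (simp add: sum.remove[of I i] a_def)
qed

lemma steiner_flip:
  assumes "\<phi> \<in> steiner I i A" "i \<in> I"
  shows "\<phi>(i := - \<phi> i) \<in> steiner I i A"
  using assms by (auto simp: steiner_def space_PiM PiE_def extensional_def)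

text \<open>
  Symmetrization in one coordinate preserves the symmetry gained in the others, since reflected base
  points have the same fibre.
\<close>

lemma steiner_flip_other:
  assumes "\<phi> \<in> steiner I i A" "i \<in> I" "j \<in> I" "j \<noteq> i"
    and flip: "\<And>\<phi>. \<phi> \<in> A \<Longrightarrow> \<phi>(j := - \<phi> j) \<in> A"
  shows "\<phi>(j := - \<phi> j) \<in> steiner I i A"
proof -
  have "(\<phi>(j := - \<phi> j))(i := t) \<in> A \<longleftrightarrow> \<phi>(i := t) \<in> A" for t
  proof
    assume "(\<phi>(j := - \<phi> j))(i := t) \<in> A"
    from flip[OF this] show "\<phi>(i := t) \<in> A" using \<open>j \<noteq> i\<close>
      by (auto simp: fun_upd_def fun_eq_iff elim!: back_subst[where P = "\<lambda>f. f \<in> A"])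
  next
    assume "\<phi>(i := t) \<in> A"
    from flip[OF this] show "(\<phi>(j := - \<phi> j))(i := t) \<in> A" using \<open>j \<noteq> i\<close>
      by (auto simp: fun_upd_def fun_eq_iff elim!: back_subst[where P = "\<lambda>f. f \<in> A"])
  qed
  then have "fibre_length i A (\<phi>(j := - \<phi> j)) = fibre_length i A \<phi>"
    by (simp add: fibre_length_def)
  then show ?thesis using assms(1-4) by (auto simp: steiner_def space_PiM PiE_def extensional_def)
qed

lemma symmetrization_exists:
  fixes A :: "('i \<Rightarrow> real) set" and d :: real
  assumes "finite I" and A: "A \<in> sets (PiM I (\<lambda>_. lborel))"
    and d: "\<And>\<phi> \<psi>. \<phi> \<in> A \<Longrightarrow> \<psi> \<in> A \<Longrightarrow> (\<Sum>j\<in>I. (\<phi> j - \<psi> j)\<^sup>2) \<le> d\<^sup>2"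
    and "finite T" "T \<subseteq> I"
  shows "\<exists>B \<in> sets (PiM I (\<lambda>_. lborel)).
     emeasure (PiM I (\<lambda>_. lborel)) B = emeasure (PiM I (\<lambda>_. lborel)) A \<and>
     (\<forall>\<phi>\<in>B. \<forall>\<psi>\<in>B. (\<Sum>j\<in>I. (\<phi> j - \<psi> j)\<^sup>2) \<le> d\<^sup>2) \<and>
     (\<forall>j\<in>T. \<forall>\<phi>\<in>B. \<phi>(j := - \<phi> j) \<in> B)"
  using \<open>finite T\<close> \<open>T \<subseteq> I\<close>
proof (induction T)
  case empty
  then show ?case using A d by auto
next
  case (insert i T)
  then have "T \<subseteq> I" by blast
  from insert.IH[OF this] obtain B where B: "B \<in> sets (PiM I (\<lambda>_. lborel))"
     "emeasure (PiM I (\<lambda>_. lborel)) B = emeasure (PiM I (\<lambda>_. lborel)) A"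
     and d': "\<And>\<phi> \<psi>. \<phi> \<in> B \<Longrightarrow> \<psi> \<in> B \<Longrightarrow> (\<Sum>j\<in>I. (\<phi> j - \<psi> j)\<^sup>2) \<le> d\<^sup>2"
     and fl: "\<And>j \<phi>. j \<in> T \<Longrightarrow> \<phi> \<in> B \<Longrightarrow> \<phi>(j := - \<phi> j) \<in> B"
    by blast
  have i: "i \<in> I" "T \<subseteq> I" using insert by auto
  show ?case
  proof (intro bexI[of _ "steiner I i B"] conjI ballI)
    fix j \<phi> assume "j \<in> insert i T" "\<phi> \<in> steiner I i B"
    then show "\<phi>(j := - \<phi> j) \<in> steiner I i B"
      using steiner_flip[OF _ i(1)] steiner_flip_other[OF _ i(1)] fl i(2) by (cases "j = i") auto
  next
    fix \<phi> \<psi> assume "\<phi> \<in> steiner I i B" "\<psi> \<in> steiner I i B"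
    then show "(\<Sum>j\<in>I. (\<phi> j - \<psi> j)\<^sup>2) \<le> d\<^sup>2"
      by (intro steiner_sq_dist_le[OF \<open>finite I\<close> i(1) d'])
  qed (use B emeasure_steiner[OF \<open>finite I\<close> i(1)] sets_steiner[OF i(1)] in auto)
qed

lemma flip_many:
  assumes "finite T" and fl: "\<And>j \<phi>. j \<in> T \<Longrightarrow> \<phi> \<in> B \<Longrightarrow> \<phi>(j := - \<phi> j) \<in> B" and "\<phi> \<in> B"
  shows "(\<lambda>j. if j \<in> T then - \<phi> j else \<phi> j) \<in> B"
  using assms(1) fl
proof (induction T)
  case empty
  then show ?case using \<open>\<phi> \<in> B\<close> by simp
next
  case (insert i T)
  let ?f = "\<lambda>j. if j \<in> T then - \<phi> j else \<phi> j"
  have "?f(i := - ?f i) \<in> B" using insert by blast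
  also have "?f(i := - ?f i) = (\<lambda>j. if j \<in> insert i T then - \<phi> j else \<phi> j)"
    using insert.hyps by auto
  finally show ?case .
qed

text \<open>
  After symmetrization in every coordinate the set is invariant under \<open>\<phi> \<mapsto> - \<phi>\<close>. A centrally symmetric set
  of diameter at most \<open>d\<close> lies in the ball of radius \<open>d / 2\<close>. The space is a finite power of the real line,
  so that the dimension is a number and not a type; this is what projections along an arbitrary direction require.
\<close>

lemma isodiametric:
  fixes A :: "('i \<Rightarrow> real) set" and d :: real
  assumes "finite I" and A: "A \<in> sets (PiM I (\<lambda>_. lborel))" and "0 \<le> d"
    and d: "\<And>\<phi> \<psi>. \<phi> \<in> A \<Longrightarrow> \<psi> \<in> A \<Longrightarrow> (\<Sum>j\<in>I. (\<phi> j - \<psi> j)\<^sup>2) \<le> d\<^sup>2"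
  shows "emeasure (PiM I (\<lambda>_. lborel)) A \<le> ennreal (unit_ball_vol (card I) * (d / 2) ^ card I)"
proof -
  let ?P = "PiM I (\<lambda>_. lborel :: real measure)"
  obtain B where B: "B \<in> sets ?P" "emeasure ?P B = emeasure ?P A"
     and d': "\<And>\<phi> \<psi>. \<phi> \<in> B \<Longrightarrow> \<psi> \<in> B \<Longrightarrow> (\<Sum>j\<in>I. (\<phi> j - \<psi> j)\<^sup>2) \<le> d\<^sup>2"
     and fl: "\<And>j \<phi>. j \<in> I \<Longrightarrow> \<phi> \<in> B \<Longrightarrow> \<phi>(j := - \<phi> j) \<in> B"
    using symmetrization_exists[OF \<open>finite I\<close> A d \<open>finite I\<close> order_refl] by blast
  have small: "sqrt (\<Sum>j\<in>I. (\<phi> j)\<^sup>2) \<le> d / 2" if "\<phi> \<in> B" for \<phi>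
  proof -
    have "(\<Sum>j\<in>I. (\<phi> j - (if j \<in> I then - \<phi> j else \<phi> j))\<^sup>2) \<le> d\<^sup>2"
      using d'[OF that flip_many[OF \<open>finite I\<close> fl that]] .
    also have "(\<Sum>j\<in>I. (\<phi> j - (if j \<in> I then - \<phi> j else \<phi> j))\<^sup>2) = 4 * (\<Sum>j\<in>I. (\<phi> j)\<^sup>2)"
      unfolding sum_distrib_left by (rule sum.cong) (simp_all add: power2_eq_square)
    finally have "(\<Sum>j\<in>I. (\<phi> j)\<^sup>2) \<le> (d / 2)\<^sup>2" by (simp add: power_divide)
    then show ?thesis using \<open>0 \<le> d\<close> by (intro real_le_lsqrt) (auto intro: sum_nonneg)
  qed
  \<comment> \<open>Radii \<open>r > d / 2\<close> first: the volume formula for balls asks for a positive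
    radius, and \<open>d\<close> may be 0.\<close>
  have le: "emeasure ?P A \<le> ennreal (unit_ball_vol (card I) * r ^ card I)" if "d / 2 < r" for r
  proof -
    have "emeasure ?P B \<le> emeasure ?P ({f. sqrt (\<Sum>i\<in>I. (f i)\<^sup>2) \<le> r} \<inter> space ?P)"
    proof (rule emeasure_mono)
      show "B \<subseteq> {f. sqrt (\<Sum>i\<in>I. (f i)\<^sup>2) \<le> r} \<inter> space ?P"
        using small that sets.sets_into_space[OF B(1)] by force
      show "{f. sqrt (\<Sum>i\<in>I. (f i)\<^sup>2) \<le> r} \<inter> space ?P \<in> sets ?P" 
        using \<open>finite I\<close> by auto
    qed
    then show ?thesis using emeasure_cball_aux[OF \<open>finite I\<close>, of r] that \<open>0 \<le> d\<close> B(2) by simp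
  qed
  have "(\<lambda>k. ennreal (unit_ball_vol (card I) * (d / 2 + 1 / real (Suc k)) ^ card I))
      \<longlonglongrightarrow> ennreal (unit_ball_vol (card I) * (d / 2 + 0) ^ card I)"
    by (intro tendsto_ennrealI tendsto_intros LIMSEQ_Suc[OF lim_1_over_n])
  then show ?thesis using le by (intro LIMSEQ_le_const[of _ _ "emeasure ?P A"]) auto
qed

section \<open>Hausdorff measure and projections onto hyperplanes\<close>

text \<open>
  The orthogonal projection of \<open>A\<close> along \<open>f\<close> contains the \<open>r\<close>-ball about the projection of \<open>c\<close> in the
  hyperplane orthogonal to \<open>f\<close>.
\<close>

definition shadows_ball :: "'a::euclidean_space set \<Rightarrow> 'a \<Rightarrow> 'a \<Rightarrow> real \<Rightarrow> bool" where
  "shadows_ball A f c r \<longleftrightarrow>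
     (\<forall>u. u \<bullet> f = 0 \<and> norm u \<le> r \<longrightarrow> (\<exists>\<tau>. c + u + \<tau> *\<^sub>R f \<in> A))"

text \<open>
  Projecting the covering sets to the hyperplane orthogonal to \<open>f\<close> covers the ball without increasing
  diameters, and the isodiametric inequality bounds the volume of each projected set by its weight.
  Only covering sets that meet \<open>A\<close> are charged, which later allows one covering to serve several sets at once.
\<close>

lemma ball_volume_le_sum_weights_of_cover:
  fixes A :: "'a::euclidean_space set"
  assumes dim: "DIM('a) = n + 1" and f: "norm f = 1" and r: "0 < r"
    and sh: "shadows_ball A f c r"
    and cov: "A \<subseteq> (\<Union>k. C k)" and bd: "\<And>k::nat. bounded (C k)"
  shows "ennreal (unit_ball_vol n * r ^ n) \<le>
    (\<Sum>k. if C k \<inter> A = {} then 0 else hausdorff_weight n (C k))"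
proof -
  obtain J where J: "J \<subseteq> {z. f \<bullet> z = 0}" "pairwise orthogonal J" "\<And>j. j \<in> J \<Longrightarrow> norm j = 1"
    "independent J" "card J = dim {z. f \<bullet> z = 0}"
    using orthonormal_basis_subspace[OF subspace_hyperplane[of f]] by metis
  have "f \<noteq> 0" using f by auto
  then have cardJ: "card J = n" using J(5) dim by (simp add: dim_hyperplane)
  have fin: "finite J" using J(4) by (rule finiteI_independent)
  have orth: "i \<bullet> j = (if i = j then 1 else 0)" if "i \<in> J" "j \<in> J" for i j
    using J(2,3) that by (auto simp: pairwise_def orthogonal_def norm_eq_1)
  let ?P = "PiM J (\<lambda>_. lborel :: real measure)"
  \<comment> \<open>The coordinates of the projection with respect to the orthonormal basis \<open>J\<close>
    of the hyperplane are \<open>p\<close>; \<open>E\<close> maps coordinates back into the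
    space.\<close>
  define E where "E = (\<lambda>\<phi>. \<Sum>j\<in>J. \<phi> j *\<^sub>R j)"
  define p where "p = (\<lambda>z. \<lambda>j\<in>J. (z - c) \<bullet> j)"
  have EJ: "E \<phi> \<bullet> j = \<phi> j" if "j \<in> J" for \<phi> j
    using that fin by (simp add: E_def inner_sum_left orth if_distrib cong: if_cong)
  have Enorm: "(norm (E \<phi>))\<^sup>2 = (\<Sum>j\<in>J. (\<phi> j)\<^sup>2)" for \<phi>
  proof -
    have "(norm (E \<phi>))\<^sup>2 = E \<phi> \<bullet> (\<Sum>j\<in>J. \<phi> j *\<^sub>R j)"
      by (simp add: power2_norm_eq_inner E_def)
    also have "\<dots> = (\<Sum>j\<in>J. (\<phi> j)\<^sup>2)"
      by (simp add: inner_sum_right EJ power2_eq_square)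
    finally show ?thesis .
  qed
  have Ef: "E \<phi> \<bullet> f = 0" for \<phi>
    unfolding E_def inner_sum_left using J(1) by (intro sum.neutral) (auto simp: inner_commute)
  have bessel: "(\<Sum>j\<in>J. (z \<bullet> j)\<^sup>2) \<le> (norm z)\<^sup>2" for z
  proof -
    define u where "u = E (\<lambda>j. z \<bullet> j)"
    have "(norm u)\<^sup>2 = (\<Sum>j\<in>J. (z \<bullet> j)\<^sup>2)" unfolding u_def by (rule Enorm)
    also have "\<dots> = z \<bullet> u" by (simp add: u_def E_def inner_sum_right power2_eq_square)
    finally have zu: "(norm u)\<^sup>2 = z \<bullet> u" .
    have "(norm u)\<^sup>2 \<le> norm z * norm u" unfolding zu by (rule norm_cauchy_schwarz)
    then have "norm u \<le> norm z" by (cases "u = 0") (auto simp: power2_eq_square)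
    then show ?thesis using Enorm[of "\<lambda>j. z \<bullet> j"] power_mono[of "norm u" "norm z" 2]
      by (simp add: u_def)
  qed
  have Em: "E \<in> measurable ?P borel"
    unfolding E_def
  proof (intro borel_measurable_sum borel_measurable_scaleR borel_measurable_const)
    show "(\<lambda>\<phi>. \<phi> j) \<in> borel_measurable ?P" if "j \<in> J" for j
      using measurable_component_singleton[OF that, of "\<lambda>_. lborel :: real measure"] by simp
  qed
  \<comment> \<open>Taking closures makes the projected pieces compact, hence measurable, and does not
    change the diameters.\<close>
  define Q where "Q = (\<lambda>k. p ` closure (C k \<inter> A))"
  have Qs: "Q k \<in> sets ?P" for k
  proof -
    have "continuous_on UNIV (\<lambda>z. E (\<lambda>j. (z - c) \<bullet> j))" unfolding E_def by (intro continuous_intros)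
    then have "compact ((\<lambda>z. E (\<lambda>j. (z - c) \<bullet> j)) ` closure (C k \<inter> A))"
      using bd[of k] by (intro compact_continuous_image) (auto intro: continuous_on_subset bounded_subset)
    then have b: "(\<lambda>z. E (\<lambda>j. (z - c) \<bullet> j)) ` closure (C k \<inter> A) \<in> sets borel" by (simp add: borel_compact)
    have "Q k = E -` ((\<lambda>z. E (\<lambda>j. (z - c) \<bullet> j)) ` closure (C k \<inter> A)) \<inter> space ?P"
    proof (intro set_eqI iffI)
      fix \<phi> assume "\<phi> \<in> Q k"
      then obtain z where z: "z \<in> closure (C k \<inter> A)" "\<phi> = p z" by (auto simp: Q_def)
      moreover have "E (p z) = E (\<lambda>j. (z - c) \<bullet> j)" by (simp add: E_def p_def)
      ultimately show "\<phi> \<in> E -` ((\<lambda>z. E (\<lambda>j. (z - c) \<bullet> j)) ` closure (C k \<inter> A)) \<inter> space ?P"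
        by (auto simp: space_PiM p_def)
    next
      fix \<phi> assume "\<phi> \<in> E -` ((\<lambda>z. E (\<lambda>j. (z - c) \<bullet> j)) ` closure (C k \<inter> A)) \<inter> space ?P"
      then obtain z where z: "z \<in> closure (C k \<inter> A)" "E \<phi> = E (\<lambda>j. (z - c) \<bullet> j)"
        and sp: "\<phi> \<in> space ?P" by auto
      have "\<phi> j = (z - c) \<bullet> j" if "j \<in> J" for j
        using EJ[OF that, of \<phi>] EJ[OF that, of "\<lambda>j. (z - c) \<bullet> j"] z(2) by simp
      then have "\<phi> = p z" using sp by (auto simp: space_PiM PiE_def extensional_def p_def fun_eq_iff)
      then show "\<phi> \<in> Q k" using z(1) by (auto simp: Q_def)
    qed
    then show ?thesis using measurable_sets[OF Em b] by simp
  qed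
  have Qle: "emeasure ?P (Q k) \<le> (if C k \<inter> A = {} then 0 else hausdorff_weight n (C k))" for k
  proof (cases "C k \<inter> A = {}")
    case False
    have "(\<Sum>j\<in>J. (\<phi> j - \<psi> j)\<^sup>2) \<le> (diameter (C k))\<^sup>2" if in_Q: "\<phi> \<in> Q k" "\<psi> \<in> Q k" for \<phi> \<psi>
    proof -
      obtain z w where zw: "z \<in> closure (C k \<inter> A)" "w \<in> closure (C k \<inter> A)" "\<phi> = p z" "\<psi> = p w"
        using in_Q by (auto simp: Q_def)
      then have "z \<in> closure (C k)" "w \<in> closure (C k)" using closure_mono[of "C k \<inter> A" "C k"] by auto
      then have "dist z w \<le> diameter (C k)"
        using diameter_bounded_bound[of "closure (C k)" z w] bd[of k]
        by (simp add: diameter_closure bounded_closure)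
      moreover have "(\<Sum>j\<in>J. (\<phi> j - \<psi> j)\<^sup>2) = (\<Sum>j\<in>J. ((z - w) \<bullet> j)\<^sup>2)"
        by (rule sum.cong) (simp_all add: zw p_def inner_diff_left)
      ultimately show ?thesis
        using bessel[of "z - w"] power_mono[of "norm (z - w)" "diameter (C k)" 2] by (simp add: dist_norm)
    qed
    from isodiametric[OF fin Qs diameter_ge_0[OF bd] this] False show ?thesis
      by (auto simp: hausdorff_weight_def cardJ)
  qed (simp add: Q_def)
  let ?B = "{\<phi>. sqrt (\<Sum>j\<in>J. (\<phi> j)\<^sup>2) \<le> r} \<inter> space ?P"
  have "?B \<subseteq> (\<Union>k. Q k)"
  proof
    fix \<phi> assume phi: "\<phi> \<in> ?B"
    then have "norm (E \<phi>) \<le> r" using Enorm[of \<phi>] by (metis IntD1 mem_Collect_eq norm_ge_zero real_sqrt_unique)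
    then obtain \<tau> where a: "c + E \<phi> + \<tau> *\<^sub>R f \<in> A" using sh Ef[of \<phi>] unfolding shadows_ball_def by blast
    then obtain k where "c + E \<phi> + \<tau> *\<^sub>R f \<in> C k \<inter> A" using cov by blast
    then have "p (c + E \<phi> + \<tau> *\<^sub>R f) \<in> Q k" unfolding Q_def using closure_subset by blast
    moreover have "p (c + E \<phi> + \<tau> *\<^sub>R f) = \<phi>"
      using phi J(1) by (auto simp: p_def fun_eq_iff space_PiM PiE_def extensional_def inner_add_left EJ)
    ultimately show "\<phi> \<in> (\<Union>k. Q k)" by auto
  qed
  then have "emeasure ?P ?B \<le> emeasure ?P (\<Union>k. Q k)" using Qs by (intro emeasure_mono) auto
  also have "\<dots> \<le> (\<Sum>k. emeasure ?P (Q k))" using Qs by (intro emeasure_subadditive_countably) auto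
  also have "\<dots> \<le> (\<Sum>k. if C k \<inter> A = {} then 0 else hausdorff_weight n (C k))"
    using Qle by (intro suminf_le) auto
  finally show ?thesis using emeasure_cball_aux[OF fin r] by (simp add: cardJ)
qed

lemma sum_le_single:
  fixes w :: ennreal
  assumes "finite I" "\<And>i j. i \<in> I \<Longrightarrow> j \<in> I \<Longrightarrow> P i \<Longrightarrow> P j \<Longrightarrow> i = j"
  shows "(\<Sum>i\<in>I. if P i then w else 0) \<le> w"
proof (cases "\<exists>i\<in>I. P i")
  case True
  then obtain i where "i \<in> I" "P i" by auto
  then have "(\<Sum>j\<in>I. if P j then w else 0) = (\<Sum>j\<in>I. if j = i then w else 0)"
    using assms(2) by (intro sum.cong) auto
  then show ?thesis using assms(1) \<open>i \<in> I\<close> by simp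
qed (auto simp: sum.neutral)

text \<open>
  Additivity for separated pieces, directly at the level of coverings: a set of diameter at most \<open>\<delta> / 2\<close>
  meets at most one of them, so each covering set pays for a single piece. Each piece may be projected along
  its own direction.
\<close>

lemma hausdorff_measure_ge_sum_of_shadows:
  fixes M :: "'a::euclidean_space set"
  assumes dim: "DIM('a) = n + 1" and fin: "finite I" and delta: "0 < \<delta>"
    and AM: "\<And>i. i \<in> I \<Longrightarrow> A i \<subseteq> M"
    and f: "\<And>i. i \<in> I \<Longrightarrow> norm (f i) = 1" and r: "\<And>i. i \<in> I \<Longrightarrow> 0 < r i"
    and sh: "\<And>i. i \<in> I \<Longrightarrow> shadows_ball (A i) (f i) (c i) (r i)"
    and sep: "\<And>i j a b. i \<in> I \<Longrightarrow> j \<in> I \<Longrightarrow> i \<noteq> j \<Longrightarrow> a \<in> A i \<Longrightarrow> b \<in> A j \<Longrightarrow> \<delta> \<le> dist a b"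
  shows "ennreal (\<Sum>i\<in>I. unit_ball_vol n * r i ^ n) \<le> hausdorff_measure n M"
proof -
  have "ennreal (\<Sum>i\<in>I. unit_ball_vol n * r i ^ n) \<le> (\<Sum>k. hausdorff_weight n (C k))"
    if C: "M \<subseteq> (\<Union>k. C k)" "\<And>k. bounded (C k)" "\<And>k. diameter (C k) \<le> \<delta> / 2" for C :: "nat \<Rightarrow> 'a set"
  proof -
    let ?w = "\<lambda>i k. if C k \<inter> A i \<noteq> {} then hausdorff_weight n (C k) else 0"
    have flip: "?w i k = (if C k \<inter> A i = {} then 0 else hausdorff_weight n (C k))" for i k
      by simp
    have one: "i = j" if both: "i \<in> I" "j \<in> I" "C k \<inter> A i \<noteq> {}" "C k \<inter> A j \<noteq> {}" for i j k
    proof (rule ccontr)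
      assume "i \<noteq> j"
      obtain a b where "a \<in> C k" "a \<in> A i" "b \<in> C k" "b \<in> A j" using both by blast
      then have "\<delta> \<le> dist a b" "dist a b \<le> \<delta> / 2"
        using sep[of i j a b] both \<open>i \<noteq> j\<close> diameter_bounded_bound[OF C(2), of a k b] C(3)[of k] by auto
      then show False using delta by simp
    qed
    have "ennreal (\<Sum>i\<in>I. unit_ball_vol n * r i ^ n) = (\<Sum>i\<in>I. ennreal (unit_ball_vol n * r i ^ n))"
      using r by (subst sum_ennreal) (auto intro: less_imp_le)
    also have "\<dots> \<le> (\<Sum>i\<in>I. \<Sum>k. ?w i k)"
    proof (rule sum_mono)
      fix i assume i: "i \<in> I"
      have "A i \<subseteq> (\<Union>k. C k)" using AM[OF i] C(1) by auto
      from ball_volume_le_sum_weights_of_cover[OF dim f[OF i] r[OF i] sh[OF i] this C(2)]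
      show "ennreal (unit_ball_vol n * r i ^ n) \<le> (\<Sum>k. ?w i k)"
        unfolding flip .
    qed
    also have "\<dots> = (\<Sum>k. \<Sum>i\<in>I. ?w i k)" by (rule suminf_sum[symmetric]) auto
    also have "\<dots> \<le> (\<Sum>k. hausdorff_weight n (C k))"
      using one by (intro suminf_le sum_le_single[OF fin]) auto
    finally show ?thesis .
  qed
  then have "ennreal (\<Sum>i\<in>I. unit_ball_vol n * r i ^ n) \<le> hausdorff_premeasure n (\<delta> / 2) M"
    unfolding hausdorff_premeasure_def by (intro INF_greatest) auto
  also have "\<dots> \<le> hausdorff_measure n M"
    unfolding hausdorff_measure_def using delta by (intro SUP_upper) auto
  finally show ?thesis .
qed

section \<open>Intrinsic distance and paths outside a convex body\<close>

text \<open>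
  \<open>\<Phi> t - \<Phi> s\<close> bounds the length of \<open>g\<close> between the times \<open>s\<close> and \<open>t\<close>. Bounds in this form are additive under
  concatenation and pass to images under 1-Lipschitz maps, without handling partitions.
\<close>

definition length_at_most :: "(real \<Rightarrow> 'a::metric_space) \<Rightarrow> real \<Rightarrow> bool" where
  "length_at_most g L \<longleftrightarrow>
     (\<exists>\<Phi>. \<Phi> 0 = 0 \<and> \<Phi> 1 = L \<and>
       (\<forall>s t. 0 \<le> s \<and> s \<le> t \<and> t \<le> 1 \<longrightarrow> dist (g s) (g t) \<le> \<Phi> t - \<Phi> s))"

lemma path_length_le:
  assumes "length_at_most g L"
  shows "path_length g \<le> ennreal L"
proof -
  obtain \<Phi> where \<Phi>: "\<Phi> 0 = 0" "\<Phi> 1 = L"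
    and d: "\<And>s t. 0 \<le> s \<Longrightarrow> s \<le> t \<Longrightarrow> t \<le> 1 \<Longrightarrow> dist (g s) (g t) \<le> \<Phi> t - \<Phi> s"
    using assms unfolding length_at_most_def by blast
  have mono: "\<Phi> s \<le> \<Phi> t" if "0 \<le> s" "s \<le> t" "t \<le> 1" for s t
    using d[OF that] zero_le_dist[of "g s" "g t"] by linarith
  have "(\<Sum>i<k. ennreal (dist (g (t i)) (g (t (Suc i))))) \<le> ennreal L"
    if t: "mono t" "range t \<subseteq> {0..1}" for k :: nat and t :: "nat \<Rightarrow> real"
  proof -
    have t01: "0 \<le> t i" "t i \<le> 1" for i using subsetD[OF t(2) rangeI[of t i]] by auto
    have "(\<Sum>i<k. dist (g (t i)) (g (t (Suc i)))) \<le> (\<Sum>i<k. \<Phi> (t (Suc i)) - \<Phi> (t i))"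
      using t01 monoD[OF t(1)] by (intro sum_mono d) auto
    also have "\<dots> = \<Phi> (t k) - \<Phi> (t 0)" by (rule sum_lessThan_telescope)
    also have "\<dots> \<le> L" using mono[of 0 "t 0"] mono[of "t k" 1] t01[of 0] t01[of k] \<Phi> by linarith
    finally show ?thesis by (simp add: sum_ennreal ennreal_leI)
  qed
  then show ?thesis unfolding path_length_def by (intro SUP_least) auto
qed

lemma length_at_most_linepath: "length_at_most (linepath a b) (dist a b)"
  unfolding length_at_most_def
proof (intro exI[of _ "\<lambda>t. t * dist a b"] conjI allI impI)
  fix s t :: real assume st: "0 \<le> s \<and> s \<le> t \<and> t \<le> 1"
  have "linepath a b s - linepath a b t = (t - s) *\<^sub>R (a - b)"
    by (simp add: linepath_def algebra_simps)
  then have "dist (linepath a b s) (linepath a b t) = \<bar>t - s\<bar> * dist a b"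
    by (simp add: dist_norm)
  then show "dist (linepath a b s) (linepath a b t) \<le> t * dist a b - s * dist a b"
    using st by (simp add: algebra_simps)
qed auto

lemma length_at_most_join:
  assumes "length_at_most g1 L1" "length_at_most g2 L2" and eq: "pathfinish g1 = pathstart g2"
  shows "length_at_most (g1 +++ g2) (L1 + L2)"
proof -
  obtain F1 where F1: "F1 0 = 0" "F1 1 = L1"
    and d1: "\<And>s t. 0 \<le> s \<Longrightarrow> s \<le> t \<Longrightarrow> t \<le> 1 \<Longrightarrow> dist (g1 s) (g1 t) \<le> F1 t - F1 s"
    using assms(1) unfolding length_at_most_def by blast
  obtain F2 where F2: "F2 0 = 0" "F2 1 = L2"
    and d2: "\<And>s t. 0 \<le> s \<Longrightarrow> s \<le> t \<Longrightarrow> t \<le> 1 \<Longrightarrow> dist (g2 s) (g2 t) \<le> F2 t - F2 s"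
    using assms(2) unfolding length_at_most_def by blast
  let ?F = "\<lambda>t::real. if t \<le> 1/2 then F1 (2 * t) else L1 + F2 (2 * t - 1)"
  show ?thesis unfolding length_at_most_def
  proof (intro exI[of _ ?F] conjI allI impI)
    fix s t :: real assume st: "0 \<le> s \<and> s \<le> t \<and> t \<le> 1"
    consider "t \<le> 1/2" | "1/2 < s" | "s \<le> 1/2" "1/2 < t" by linarith
    then show "dist ((g1 +++ g2) s) ((g1 +++ g2) t) \<le> ?F t - ?F s"
    proof cases
      case 1
      then show ?thesis using st d1[of "2 * s" "2 * t"] by (simp add: joinpaths_def)
    next
      case 2
      then show ?thesis using st d2[of "2 * s - 1" "2 * t - 1"] by (simp add: joinpaths_def)
    next
      case 3
      have "dist (g1 (2 * s)) (g2 (2 * t - 1)) \<le> dist (g1 (2 * s)) (g1 1) + dist (g2 0) (g2 (2 * t - 1))"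
        using eq dist_triangle[of "g1 (2 * s)" "g2 (2 * t - 1)" "g1 1"] by (simp add: pathfinish_def pathstart_def)
      then show ?thesis using 3 st d1[of "2 * s" 1] d2[of 0 "2 * t - 1"] F1 F2 by (simp add: joinpaths_def)
    qed
  qed (use F1 F2 in auto)
qed

text \<open>
  The nearest-point map onto \<open>K\<close> is 1-Lipschitz, fixes the end points, and sends every point outside the
  interior of \<open>K\<close> to the boundary.
\<close>

lemma intrinsic_dist_frontier_le_outer_path:
  fixes K :: "'a::euclidean_space set"
  assumes K: "closed K" "convex K" "interior K \<noteq> {}"
    and g: "path g" "path_image g \<inter> interior K = {}" "pathstart g \<in> K" "pathfinish g \<in> K"
    and L: "length_at_most g L"
  shows "intrinsic_dist (frontier K) (pathstart g) (pathfinish g) \<le> ennreal L"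
proof -
  have ne: "K \<noteq> {}" using K(3) interior_subset by auto
  define k where "k = closest_point K \<circ> g"
  have "path k" unfolding k_def
    using g(1) by (intro path_continuous_image continuous_on_closest_point K ne)
  moreover have "path_image k \<subseteq> frontier K"
  proof -
    have "closest_point K z \<in> frontier K" if "z \<in> path_image g" for z
      using closest_point_in_rel_frontier[OF K(1) ne, of z] that g(2) K(3)
      by (auto simp: rel_interior_nonempty_interior rel_frontier_nonempty_interior affine_hull_nonempty_interior)
    then show ?thesis by (auto simp: k_def path_image_compose)
  qed
  moreover have "pathstart k = pathstart g" "pathfinish k = pathfinish g"
    using g(3,4) by (simp_all add: k_def pathstart_compose pathfinish_compose closest_point_self)
  moreover have "length_at_most k L"
    using L closest_point_lipschitz[OF K(2,1) ne] unfolding length_at_most_def k_def comp_def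
    by (elim ex_forward) (auto intro: order_trans[OF closest_point_lipschitz[OF K(2,1) ne]])
  then have "path_length k \<le> ennreal L" by (rule path_length_le)
  ultimately show ?thesis unfolding intrinsic_dist_def by (intro INF_lower2[of k]) auto
qed

lemma interior_point_perturb:
  fixes K :: "'a::real_normed_vector set"
  assumes "z \<in> interior K"
  obtains \<tau> where "0 < \<tau>" "z + \<tau> *\<^sub>R w \<in> K" "z - \<tau> *\<^sub>R w \<in> K"
proof -
  obtain d where d: "0 < d" "ball z d \<subseteq> K" using assms by (meson mem_interior)
  define \<tau> where "\<tau> = d / (2 * (norm w + 1))"
  have pos: "0 < norm w + 1" by (simp add: add_nonneg_pos)
  have "0 < \<tau>" using d pos by (simp add: \<tau>_def)
  moreover have "\<tau> * norm w < d"
  proof -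
    have "\<tau> * norm w \<le> \<tau> * (norm w + 1)" using \<open>0 < \<tau>\<close> by (intro mult_left_mono) auto
    also have "\<dots> = d / 2" using pos by (simp add: \<tau>_def field_simps)
    finally show ?thesis using d(1) by simp
  qed
  then have "z + \<tau> *\<^sub>R w \<in> ball z d" "z - \<tau> *\<^sub>R w \<in> ball z d" using \<open>0 < \<tau>\<close> by (simp_all add: dist_norm)
  ultimately show thesis using that d(2) by blast
qed

text \<open>
  The path runs along three sides of the rectangle with vertices \<open>x\<close>, \<open>x + r v\<close>, \<open>x + r v + h e\<close>, \<open>x + h e\<close>, with
  isosceles triangles of legs \<open>p\<close> and \<open>q\<close> cut off at the two corners off the line \<open>xy\<close>. Each cut replaces
  \<open>2 p\<close> by \<open>sqrt 2 * p\<close>. The bottom and the top side lie in the boundary of the slab, the far side lies where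
  \<open>K\<close> ends in direction \<open>v\<close>; so none of them meets the interior of \<open>K\<close>.
\<close>

lemma intrinsic_dist_le_truncated_rectangle:
  fixes K :: "'a::euclidean_space set"
  assumes K: "closed K" "convex K" "interior K \<noteq> {}"
    and e: "norm e = 1" and v: "norm v = 1" "v \<bullet> e = 0"
    and xy: "x \<in> K" "x + h *\<^sub>R e \<in> K"
    and slab: "\<And>z. z \<in> K \<Longrightarrow> 0 \<le> (z - x) \<bullet> e" "\<And>z. z \<in> K \<Longrightarrow> (z - x) \<bullet> e \<le> h"
    and r: "\<And>s t. x + s *\<^sub>R v + t *\<^sub>R e \<in> K \<Longrightarrow> s \<le> r"
    and p: "0 \<le> p" "p \<le> r" "p \<le> h / 2" and q: "0 \<le> q" "q \<le> r" "q \<le> h / 2"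
    and cut_p: "closed_segment (x + (r - p) *\<^sub>R v) (x + r *\<^sub>R v + p *\<^sub>R e) \<inter> interior K = {}"
    and cut_q: "closed_segment (x + r *\<^sub>R v + (h - q) *\<^sub>R e) (x + (r - q) *\<^sub>R v + h *\<^sub>R e) \<inter> interior K = {}"
  shows "intrinsic_dist (frontier K) x (x + h *\<^sub>R e) \<le> ennreal (2 * r + h - (2 - sqrt 2) * (p + q))"
proof -
  have ee: "e \<bullet> e = 1" "v \<bullet> v = 1" "e \<bullet> v = 0" using e v by (simp_all add: norm_eq_1 inner_commute)
  have bottom: "z \<notin> interior K" if "(z - x) \<bullet> e = 0" for z
  proof
    assume "z \<in> interior K"
    then obtain \<tau> where "0 < \<tau>" "z - \<tau> *\<^sub>R e \<in> K" using interior_point_perturb[of z K e] by blast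
    with slab(1) that show False by (force simp: inner_diff_left ee)
  qed
  have top: "z \<notin> interior K" if "(z - x) \<bullet> e = h" for z
  proof
    assume "z \<in> interior K"
    then obtain \<tau> where "0 < \<tau>" "z + \<tau> *\<^sub>R e \<in> K" using interior_point_perturb[of z K e] by blast
    with slab(2) that show False by (force simp: inner_diff_left inner_add_left ee)
  qed
  have side: "x + r *\<^sub>R v + t *\<^sub>R e \<notin> interior K" for t
  proof
    assume "x + r *\<^sub>R v + t *\<^sub>R e \<in> interior K"
    then obtain \<tau> where "0 < \<tau>" "x + r *\<^sub>R v + t *\<^sub>R e + \<tau> *\<^sub>R v \<in> K"
      using interior_point_perturb[of _ K v] by blast
    then show False using r[of "r + \<tau>" t] by (simp add: algebra_simps)
  qed
  define a where "a = x + (r - p) *\<^sub>R v"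
  define b where "b = x + r *\<^sub>R v + p *\<^sub>R e"
  define c where "c = x + r *\<^sub>R v + (h - q) *\<^sub>R e"
  define d where "d = x + (r - q) *\<^sub>R v + h *\<^sub>R e"
  define y where "y = x + h *\<^sub>R e"
  define g where "g = linepath x a +++ linepath a b +++ linepath b c +++ linepath c d +++ linepath d y"
  have s1: "closed_segment x a \<inter> interior K = {}"
  proof -
    have "z \<notin> interior K" if z: "z \<in> closed_segment x a" for z
    proof -
      obtain u where "z = (1 - u) *\<^sub>R x + u *\<^sub>R a" using z by (auto simp: closed_segment_def)
      then have "z = x + (u * (r - p)) *\<^sub>R v" by (simp add: a_def algebra_simps)
      then show ?thesis using bottom v by simp
    qed
    then show ?thesis by auto
  qed
  have s3: "closed_segment b c \<inter> interior K = {}"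
  proof -
    have "z \<notin> interior K" if z: "z \<in> closed_segment b c" for z
    proof -
      obtain u where "z = (1 - u) *\<^sub>R b + u *\<^sub>R c" using z by (auto simp: closed_segment_def)
      then have "z = x + r *\<^sub>R v + ((1 - u) * p + u * (h - q)) *\<^sub>R e" by (simp add: b_def c_def algebra_simps)
      then show ?thesis using side by simp
    qed
    then show ?thesis by auto
  qed
  have s5: "closed_segment d y \<inter> interior K = {}"
  proof -
    have "z \<notin> interior K" if z: "z \<in> closed_segment d y" for z
    proof -
      obtain u where "z = (1 - u) *\<^sub>R d + u *\<^sub>R y" using z by (auto simp: closed_segment_def)
      then have "z = x + ((1 - u) * (r - q)) *\<^sub>R v + h *\<^sub>R e" by (simp add: d_def y_def algebra_simps)
      then show ?thesis using top[of z] v by (simp add: inner_add_left ee)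
    qed
    then show ?thesis by auto
  qed
  have "path g" by (simp add: g_def)
  moreover have "path_image g \<inter> interior K = {}"
    using s1 s3 s5 cut_p cut_q by (auto simp: g_def path_image_join a_def b_def c_def d_def)
  moreover have "pathstart g = x" "pathfinish g = y" by (simp_all add: g_def)
  moreover have "length_at_most g (dist x a + (dist a b + (dist b c + (dist c d + dist d y))))"
    unfolding g_def by (intro length_at_most_join length_at_most_linepath) auto
  moreover have "dist x a + (dist a b + (dist b c + (dist c d + dist d y))) = 2 * r + h - (2 - sqrt 2) * (p + q)"
  proof -
    have "norm (v + e) = sqrt 2" "norm (v - e) = sqrt 2"
      by (simp_all add: norm_eq_sqrt_inner inner_add_left inner_add_right inner_diff_left inner_diff_right ee v)
    moreover have "x - a = (- (r - p)) *\<^sub>R v" "a - b = (- p) *\<^sub>R (v + e)" "b - c = (- (h - q - p)) *\<^sub>R e"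
      "c - d = q *\<^sub>R (v - e)" "d - y = (r - q) *\<^sub>R v"
      by (simp_all add: a_def b_def c_def d_def y_def algebra_simps)
    ultimately have "dist x a = r - p" "dist a b = p * sqrt 2" "dist b c = h - q - p" "dist c d = q * sqrt 2" "dist d y = r - q"
      using p q by (simp_all only: dist_norm norm_scaleR e v) auto
    then show ?thesis by (simp add: algebra_simps)
  qed
  ultimately show ?thesis using intrinsic_dist_frontier_le_outer_path[OF K, of g] xy by (auto simp: y_def)
qed

text \<open>
  A corner outside the closed set \<open>K\<close> has a whole neighbourhood outside \<open>K\<close>, inside which the path may take
  the shortcut.
\<close>

lemma intrinsic_dist_less_rectangle:
  fixes K :: "'a::euclidean_space set"
  assumes K: "closed K" "convex K" "interior K \<noteq> {}"
    and e: "norm e = 1" and v: "norm v = 1" "v \<bullet> e = 0" and h: "0 < h"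
    and xy: "x \<in> K" "x + h *\<^sub>R e \<in> K"
    and slab: "\<And>z. z \<in> K \<Longrightarrow> 0 \<le> (z - x) \<bullet> e" "\<And>z. z \<in> K \<Longrightarrow> (z - x) \<bullet> e \<le> h"
    and r: "\<And>s t. x + s *\<^sub>R v + t *\<^sub>R e \<in> K \<Longrightarrow> s \<le> r" and "0 < r"
    and corner: "x + r *\<^sub>R v \<notin> K \<or> x + r *\<^sub>R v + h *\<^sub>R e \<notin> K"
  shows "intrinsic_dist (frontier K) x (x + h *\<^sub>R e) < ennreal (2 * r + h)"
proof -
  have far: "\<exists>p. 0 < p \<and> p \<le> r \<and> p \<le> h / 2 \<and> ball c (2 * p) \<inter> K = {}" if "c \<notin> K" for c
  proof -
    obtain d where "0 < d" "ball c d \<subseteq> - K" 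
      using \<open>c \<notin> K\<close> K(1) open_contains_ball[of "- K"] by auto
    then show ?thesis using h \<open>0 < r\<close>
      by (intro exI[of _ "min (d / 2) (min r (h / 2))"]) (force simp: min_def)
  qed
  have seg: "closed_segment a b \<inter> interior K = {}"
    if ab: "dist c a < 2 * p" "dist c b < 2 * p" "ball c (2 * p) \<inter> K = {}" for a b c p
  proof -
    have "closed_segment a b \<subseteq> ball c (2 * p)" using ab by (intro closed_segment_subset) auto
    then show ?thesis using ab interior_subset[of K] by auto
  qed
  have notint: "x + r *\<^sub>R v \<notin> interior K" "x + r *\<^sub>R v + h *\<^sub>R e \<notin> interior K"
  proof -
    have "z \<notin> interior K" if "z = x + r *\<^sub>R v + t *\<^sub>R e" for z t
    proof
      assume "z \<in> interior K"
      then obtain \<tau> where "0 < \<tau>" "z + \<tau> *\<^sub>R v \<in> K" using interior_point_perturb[of z K v] by blast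
      then show False using r[of "r + \<tau>" t] that by (simp add: algebra_simps)
    qed
    from this[of "x + r *\<^sub>R v" 0] this[of "x + r *\<^sub>R v + h *\<^sub>R e" h]
    show "x + r *\<^sub>R v \<notin> interior K" "x + r *\<^sub>R v + h *\<^sub>R e \<notin> interior K"
      by auto
  qed
  have "\<exists>p>0. intrinsic_dist (frontier K) x (x + h *\<^sub>R e) \<le> ennreal (2 * r + h - (2 - sqrt 2) * p)"
  proof (cases "x + r *\<^sub>R v \<in> K")
    case False
    then obtain p where p: "0 < p" "p \<le> r" "p \<le> h / 2" "ball (x + r *\<^sub>R v) (2 * p) \<inter> K = {}" using far by blast
    have "intrinsic_dist (frontier K) x (x + h *\<^sub>R e) \<le> ennreal (2 * r + h - (2 - sqrt 2) * (p + 0))"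
    proof (rule intrinsic_dist_le_truncated_rectangle[OF K e v xy slab r])
      show "closed_segment (x + (r - p) *\<^sub>R v) (x + r *\<^sub>R v + p *\<^sub>R e) \<inter> interior K = {}"
        using p e v by (intro seg[OF _ _ p(4)]) (simp_all add: dist_norm algebra_simps)
    qed (use p h notint in auto)
    then show ?thesis using p(1) by auto
  next
    case True
    with corner obtain p where p: "0 < p" "p \<le> r" "p \<le> h / 2" "ball (x + r *\<^sub>R v + h *\<^sub>R e) (2 * p) \<inter> K = {}"
      using far by blast
    have "intrinsic_dist (frontier K) x (x + h *\<^sub>R e) \<le> ennreal (2 * r + h - (2 - sqrt 2) * (0 + p))"
    proof (rule intrinsic_dist_le_truncated_rectangle[OF K e v xy slab r])
      show "closed_segment (x + r *\<^sub>R v + (h - p) *\<^sub>R e) (x + (r - p) *\<^sub>R v + h *\<^sub>R e) \<inter> interior K = {}"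
        using p e v by (intro seg[OF _ _ p(4)]) (simp_all add: dist_norm algebra_simps)
    qed (use p h notint in auto)
    then show ?thesis using p(1) by auto
  qed
  then obtain p where "0 < p" and le: "intrinsic_dist (frontier K) x (x + h *\<^sub>R e) \<le> ennreal (2 * r + h - (2 - sqrt 2) * p)"
    by blast
  have "sqrt 2 < 2" using real_sqrt_less_mono[of 2 4] by simp
  then have "0 < (2 - sqrt 2) * p" using \<open>0 < p\<close> by simp
  then have "ennreal (2 * r + h - (2 - sqrt 2) * p) < ennreal (2 * r + h)"
    using h \<open>0 < r\<close> by (intro ennreal_lessI) auto
  then show ?thesis using le by simp
qed

section \<open>Sheets of a convex body and the area of its boundary\<close>

lemma norm_orthogonal_add_ge:
  fixes e w :: "'a::real_inner"
  assumes "norm e = 1" "w \<bullet> e = 0"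
  shows "norm w \<le> norm (w + s *\<^sub>R e)" "\<bar>s\<bar> \<le> norm (w + s *\<^sub>R e)"
proof -
  have "(norm (w + s *\<^sub>R e))\<^sup>2 = (norm w)\<^sup>2 + s\<^sup>2"
    unfolding power2_norm_eq_inner using assms
    by (simp add: inner_add_left inner_add_right inner_commute norm_eq_1 power2_eq_square)
  then have "(norm w)\<^sup>2 \<le> (norm (w + s *\<^sub>R e))\<^sup>2" "\<bar>s\<bar>\<^sup>2 \<le> (norm (w + s *\<^sub>R e))\<^sup>2" by auto
  then show "norm w \<le> norm (w + s *\<^sub>R e)" "\<bar>s\<bar> \<le> norm (w + s *\<^sub>R e)"
    by (metis norm_ge_zero power2_le_imp_le)+
qed

text \<open>
  The part of \<open>K\<close> where the lines in direction \<open>f\<close> leave \<open>K\<close>: the graph of a concave function over the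
  projection of \<open>K\<close> if \<open>K\<close> is compact and convex.
\<close>

definition sheet :: "'a::real_normed_vector set \<Rightarrow> 'a \<Rightarrow> 'a set" where
  "sheet K f = {z \<in> K. \<forall>\<tau>>0. z + \<tau> *\<^sub>R f \<notin> K}"

lemma sheet_subset_frontier: "sheet K f \<subseteq> frontier K"
proof
  fix z assume z: "z \<in> sheet K f"
  then have "z \<notin> interior K" by (auto simp: sheet_def elim: interior_point_perturb[where w = f])
  then show "z \<in> frontier K" using z closure_subset by (auto simp: sheet_def frontier_def)
qed

lemma ray_exits_through_sheet:
  fixes K :: "'a::real_normed_vector set"
  assumes K: "compact K" and f: "f \<noteq> 0" and w: "w \<in> K"
  obtains \<tau> where "w + \<tau> *\<^sub>R f \<in> sheet K f"
proof -
  let ?S = "{\<tau>. w + \<tau> *\<^sub>R f \<in> K}"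
  have "closed ((\<lambda>\<tau>. w + \<tau> *\<^sub>R f) -` K)"
    by (intro closed_vimage compact_imp_closed[OF K] continuous_intros)
  moreover have "bounded ?S"
  proof -
    obtain b where b: "\<And>z. z \<in> K \<Longrightarrow> norm z \<le> b" using compact_imp_bounded[OF K] by (auto simp: bounded_iff)
    have "\<bar>\<tau>\<bar> \<le> (b + norm w) / norm f" if "w + \<tau> *\<^sub>R f \<in> K" for \<tau>
    proof -
      have "\<bar>\<tau>\<bar> * norm f = norm ((w + \<tau> *\<^sub>R f) - w)" by simp
      also have "\<dots> \<le> b + norm w" using b[OF that] norm_triangle_ineq4[of "w + \<tau> *\<^sub>R f" w] by linarith
      finally show ?thesis using f by (simp add: field_simps)
    qed
    then show ?thesis by (auto simp: bounded_iff)
  qed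
  ultimately have "compact ?S" by (simp add: compact_eq_bounded_closed vimage_def)
  moreover have "?S \<noteq> {}" using w by (auto intro: exI[of _ 0])
  ultimately obtain \<tau> where \<tau>: "\<tau> \<in> ?S" "\<And>\<sigma>. \<sigma> \<in> ?S \<Longrightarrow> \<sigma> \<le> \<tau>" using compact_attains_sup by metis
  have "w + \<tau> *\<^sub>R f + \<sigma> *\<^sub>R f \<notin> K" if "0 < \<sigma>" for \<sigma>
    using \<tau>(2)[of "\<tau> + \<sigma>"] that by (auto simp: scaleR_add_left add.assoc)
  then show thesis using \<tau>(1) that by (auto simp: sheet_def)
qed

definition sheet_over :: "'a::euclidean_space set \<Rightarrow> 'a \<Rightarrow> 'a \<Rightarrow> real \<Rightarrow> 'a set" where
  "sheet_over K f c r = {z \<in> sheet K f. \<exists>u \<tau>. u \<bullet> f = 0 \<and> norm u \<le> r \<and> z = c + u + \<tau> *\<^sub>R f}"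

lemma sheet_overE:
  assumes "z \<in> sheet_over K f c r"
  obtains u \<tau> where "u \<bullet> f = 0" "norm u \<le> r" "z = c + u + \<tau> *\<^sub>R f"
    "\<forall>\<sigma>>0. z + \<sigma> *\<^sub>R f \<notin> K"
  using assms unfolding sheet_over_def sheet_def by blast

lemma shadows_ballE:
  assumes "shadows_ball A f c r" "u \<bullet> f = 0" "norm u \<le> r"
  obtains \<tau> where "c + u + \<tau> *\<^sub>R f \<in> A"
  using assms unfolding shadows_ball_def by blast

lemma sheet_over_subset_frontier: "sheet_over K f c r \<subseteq> frontier K"
  using sheet_subset_frontier by (auto simp: sheet_over_def)

lemma shadows_ball_sheet_over:
  assumes "compact K" "f \<noteq> 0" "shadows_ball K f c r"
  shows "shadows_ball (sheet_over K f c r) f c r"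
  unfolding shadows_ball_def
proof (intro allI impI)
  fix u assume u: "u \<bullet> f = 0 \<and> norm u \<le> r"
  then obtain \<sigma> where "c + u + \<sigma> *\<^sub>R f \<in> K" using assms(3) by (auto simp: shadows_ball_def)
  then obtain \<tau> where "c + u + \<sigma> *\<^sub>R f + \<tau> *\<^sub>R f \<in> sheet K f" using ray_exits_through_sheet[OF assms(1,2)] by blast
  then have "c + u + (\<sigma> + \<tau>) *\<^sub>R f \<in> sheet K f" by (simp add: scaleR_add_left add.assoc)
  then show "\<exists>\<tau>. c + u + \<tau> *\<^sub>R f \<in> sheet_over K f c r" using u by (auto simp: sheet_over_def)
qed

lemma shadows_ball_minus:
  assumes "shadows_ball A f c r"
  shows "shadows_ball A (- f) c r"
  unfolding shadows_ball_def
proof (intro allI impI)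
  fix u assume "u \<bullet> - f = 0 \<and> norm u \<le> r"
  then obtain \<tau> where "c + u + \<tau> *\<^sub>R f \<in> A" using assms by (auto simp: shadows_ball_def)
  then have "c + u + (- \<tau>) *\<^sub>R (- f) \<in> A" by simp
  then show "\<exists>\<tau>. c + u + \<tau> *\<^sub>R - f \<in> A" by blast
qed

lemma shadows_ball_mono:
  "shadows_ball A f c r \<Longrightarrow> r' \<le> r \<Longrightarrow> shadows_ball A f c r'"
  unfolding shadows_ball_def by (meson order_trans)

text \<open>
  Shrinking the shadow a little leaves room below the upper sheet. A point \<open>u\<close> of the smaller ball is a convex
  combination \<open>(1 - l) u1 + l u0\<close> of a point \<open>u1\<close> of the larger ball and the projection \<open>u0\<close> of the centre of a
  ball of radius \<open>\<eta>\<close> in \<open>K\<close>, with the same \<open>l\<close> for all \<open>u\<close>. Hence \<open>K\<close> contains a ball of radius \<open>l \<eta>\<close> centred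
  over \<open>u\<close>, say at height \<open>m\<close>. The upper sheet over \<open>u\<close> then lies at height at least \<open>m + l \<eta> / 2\<close>, and the
  lower sheet lies at height at most \<open>m\<close> over every point within \<open>l \<eta>\<close> of \<open>u\<close>.
\<close>

lemma opposite_sheets_separated:
  fixes K :: "'a::euclidean_space set"
  assumes K: "convex K" "interior K \<noteq> {}" and e: "norm e = 1"
    and sh: "shadows_ball K e x r" and r': "0 \<le> r'" "r' < r"
  obtains \<delta> where "0 < \<delta>"
    "\<And>a b. a \<in> sheet_over K e x r' \<Longrightarrow> b \<in> sheet_over K (- e) x r' \<Longrightarrow> \<delta> \<le> dist a b"
proof -
  have ee: "e \<bullet> e = 1" using e by (simp add: norm_eq_1)
  obtain c0 \<eta> where ball: "0 < \<eta>" "ball c0 \<eta> \<subseteq> K" using K(2) by (meson all_not_in_conv mem_interior)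
  define s0 where "s0 = (c0 - x) \<bullet> e"
  define u0 where "u0 = c0 - x - s0 *\<^sub>R e"
  have u0: "u0 \<bullet> e = 0" "c0 = x + u0 + s0 *\<^sub>R e" by (simp_all add: u0_def s0_def inner_diff_left ee)
  have pos: "0 < r + norm u0" using r' by (simp add: add_pos_nonneg)
  \<comment> \<open>Any \<open>l < 1\<close> with \<open>r' + l * norm u0 \<le> (1 - l) * r\<close> works;
    half of the extreme value also ensures \<open>l < 1\<close> in the case \<open>r' =
    0\<close>, \<open>u0 = 0\<close>.\<close>
  define l where "l = (r - r') / (2 * (r + norm u0))"
  have lr: "l * (r + norm u0) = (r - r') / 2"
  proof -
    have "2 * (l * (r + norm u0)) = l * (2 * (r + norm u0))" by simp
    also have "\<dots> = r - r'" unfolding l_def using pos by (subst nonzero_eq_divide_eq[symmetric]) auto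
    finally show ?thesis by simp
  qed
  have "0 < l" using r' pos by (simp add: l_def)
  moreover have "l * (r + norm u0) < 1 * (r + norm u0)" unfolding lr mult_1 using r' norm_ge_zero[of u0] by argo
  then have "l < 1" by (rule mult_right_less_imp_less) (rule less_imp_le[OF pos])
  ultimately have l: "0 < l" "l < 1" "l * (r + norm u0) = (r - r') / 2" using lr by auto
  have "l * \<eta> / 2 \<le> dist a b" if a: "a \<in> sheet_over K e x r'" and b: "b \<in> sheet_over K (- e) x r'" for a b
  proof -
    obtain u t where u: "u \<bullet> e = 0" "norm u \<le> r'" "a = x + u + t *\<^sub>R e" and atop: "\<forall>\<tau>>0. a + \<tau> *\<^sub>R e \<notin> K"
      using a by (rule sheet_overE)
    obtain w t'' where "w \<bullet> - e = 0" "b = x + w + t'' *\<^sub>R (- e)" and bbot: "\<forall>\<tau>>0. b + \<tau> *\<^sub>R (- e) \<notin> K"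
      using b by (rule sheet_overE)
    moreover define s where "s = - t''"
    ultimately have w: "w \<bullet> e = 0" "b = x + w + s *\<^sub>R e" by simp_all
    define u1 where "u1 = (1 / (1 - l)) *\<^sub>R (u - l *\<^sub>R u0)"
    have "norm (u - l *\<^sub>R u0) \<le> r' + l * norm u0"
      using norm_triangle_ineq4[of u "l *\<^sub>R u0"] u(2) l(1) by simp
    also have "\<dots> \<le> (1 - l) * r" using l(3) r' by (simp add: algebra_simps)
    finally have "norm u1 \<le> r" using l(2) by (simp add: u1_def divide_simps mult.commute)
    moreover have "u1 \<bullet> e = 0" by (simp add: u1_def inner_diff_left u(1) u0(1))
    ultimately obtain t1 where q1: "x + u1 + t1 *\<^sub>R e \<in> K" using shadows_ballE[OF sh] by blast
    define m where "m = (1 - l) * t1 + l * s0"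
    have u1: "(1 - l) *\<^sub>R u1 + l *\<^sub>R u0 = u" using l(2) by (simp add: u1_def)
    have near: "x + u + m *\<^sub>R e + p \<in> K" if p: "norm p < l * \<eta>" for p
    proof -
      have "norm ((1 / l) *\<^sub>R p) < \<eta>" using p l(1) by (simp add: field_simps)
      then have "c0 + (1 / l) *\<^sub>R p \<in> K" using ball(2) by (auto simp: dist_norm subset_iff)
      then have "(1 - l) *\<^sub>R (x + u1 + t1 *\<^sub>R e) + l *\<^sub>R (c0 + (1 / l) *\<^sub>R p) \<in> K"
        using convexD[OF K(1) q1, of _ "1 - l" l] l by simp
      also have "(1 - l) *\<^sub>R (x + u1 + t1 *\<^sub>R e) + l *\<^sub>R (c0 + (1 / l) *\<^sub>R p)
          = x + ((1 - l) *\<^sub>R u1 + l *\<^sub>R u0) + m *\<^sub>R e + p"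
        using l(1) by (simp add: u0(2) m_def algebra_simps)
      finally show ?thesis by (simp only: u1)
    qed
    have le0: "l * \<eta> / 2 > 0" "l * \<eta> / 2 < l * \<eta>" using l(1) ball(1) by auto
    have t: "m + l * \<eta> / 2 \<le> t"
    proof (rule ccontr)
      assume "\<not> ?thesis"
      moreover have "a + (m + l * \<eta> / 2 - t) *\<^sub>R e = x + u + m *\<^sub>R e + (l * \<eta> / 2) *\<^sub>R e"
        by (simp add: u(3) algebra_simps)
      ultimately show False using near[of "(l * \<eta> / 2) *\<^sub>R e"] atop[rule_format, of "m + l * \<eta> / 2 - t"] le0 e by simp
    qed
    have ab: "a - b = (u - w) + (t - s) *\<^sub>R e" "(u - w) \<bullet> e = 0"
      using u w by (simp_all add: algebra_simps inner_diff_left)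
    note ge = norm_orthogonal_add_ge[OF e ab(2), of "t - s"]
    show ?thesis
    proof (cases "norm (w - u) < l * \<eta>")
      case True
      have "s \<le> m"
      proof (rule ccontr)
        assume "\<not> ?thesis"
        moreover have "b + (s - m) *\<^sub>R (- e) = x + u + m *\<^sub>R e + (w - u)" by (simp add: w(2) algebra_simps)
        ultimately show False using near[OF True] bbot[rule_format, of "s - m"] by simp
      qed
      then show ?thesis using t ge(2) ab(1) by (simp add: dist_norm)
    next
      case False
      then have "l * \<eta> \<le> dist a b" using ge(1) ab(1) by (simp add: dist_norm norm_minus_commute)
      then show ?thesis using le0 by linarith
    qed
  qed
  then show thesis using that[of "l * \<eta> / 2"] l(1) ball(1) by simp
qed

text \<open>
  The sheets over the ball of radius \<open>r' < r\<close> contribute \<open>2 \<omega>\<^sub>n r'\<^sup>n\<close>, which is as close to \<open>2 \<omega>\<^sub>n r\<^sup>n\<close> as desired,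
  and the contribution of \<open>B\<close> does not depend on \<open>r'\<close>. The distance from \<open>B\<close> to the sheets may depend on \<open>r'\<close>.
\<close>

lemma hausdorff_measure_gt_two_balls:
  fixes K :: "'a::euclidean_space set"
  assumes dim: "DIM('a) = n + 1"
    and K: "compact K" "convex K" "interior K \<noteq> {}" and e: "norm e = 1"
    and sh: "shadows_ball K e x r" and r: "0 < r"
    and B: "B \<subseteq> frontier K" "norm f = 1" "0 < s" "shadows_ball B f c s"
    and sep: "\<And>r'. 0 < r' \<Longrightarrow> r' < r \<Longrightarrow>
      \<exists>\<delta>>0. \<forall>a \<in> sheet_over K e x r' \<union> sheet_over K (- e) x r'. \<forall>b \<in> B. \<delta> \<le> dist a b"
  shows "ennreal (2 * unit_ball_vol n * r ^ n) < hausdorff_measure n (frontier K)"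
proof -
  have "((\<lambda>t. t ^ n) \<longlongrightarrow> r ^ n) (at_left r)" by (intro tendsto_intros)
  moreover have "r ^ n - s ^ n / 2 < r ^ n" using B(3) by simp
  ultimately have "\<forall>\<^sub>F t in at_left r. r ^ n - s ^ n / 2 < t ^ n" by (rule order_tendstoD)
  moreover have "\<forall>\<^sub>F t in at_left r. t \<in> {0<..<r}" using r by (rule eventually_at_leftI[rotated])
  ultimately have "\<forall>\<^sub>F t in at_left r. r ^ n - s ^ n / 2 < t ^ n \<and> t \<in> {0<..<r}" by (rule eventually_conj)
  then obtain t where t: "r ^ n - s ^ n / 2 < t ^ n" "0 < t" "t < r"
    using eventually_happens[of _ "at_left r"] by (auto simp: trivial_limit_at_left_real)
  have e0: "e \<noteq> 0" "- e \<noteq> 0" using e by auto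
  have sht: "shadows_ball K e x t" using shadows_ball_mono[OF sh] t(3) by simp
  obtain \<delta>1 where d1: "0 < \<delta>1"
    "\<And>a b. a \<in> sheet_over K e x t \<Longrightarrow> b \<in> sheet_over K (- e) x t \<Longrightarrow> \<delta>1 \<le> dist a b"
    using opposite_sheets_separated[OF K(2,3) e sh _ t(3)] t(2) by (metis less_imp_le)
  obtain \<delta>2 where d2: "0 < \<delta>2"
    "\<And>a b. a \<in> sheet_over K e x t \<union> sheet_over K (- e) x t \<Longrightarrow> b \<in> B \<Longrightarrow> \<delta>2 \<le> dist a b"
    using sep[OF t(2,3)] by blast
  define A where "A = (\<lambda>i::nat. if i = 0 then sheet_over K e x t else if i = 1 then sheet_over K (- e) x t else B)"
  define F where "F = (\<lambda>i::nat. if i = 0 then e else if i = 1 then - e else f)"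
  define C where "C = (\<lambda>i::nat. if i = 0 then x else if i = 1 then x else c)"
  define S where "S = (\<lambda>i::nat. if i = 0 then t else if i = 1 then t else s)"
  have "ennreal (\<Sum>i\<in>{0,1,2}. unit_ball_vol n * S i ^ n) \<le> hausdorff_measure n (frontier K)"
  proof (rule hausdorff_measure_ge_sum_of_shadows[OF dim, where A = A and f = F and c = C and \<delta> = "min \<delta>1 \<delta>2"])
    show "shadows_ball (A i) (F i) (C i) (S i)" if "i \<in> {0,1,2}" for i
      using that shadows_ball_sheet_over[OF K(1) e0(1) sht]
        shadows_ball_sheet_over[OF K(1) e0(2) shadows_ball_minus[OF sht]] B(4)
      by (auto simp: A_def F_def C_def S_def)
    show "min \<delta>1 \<delta>2 \<le> dist a b" if "i \<in> {0,1,2}" "j \<in> {0,1,2}" "i \<noteq> j" "a \<in> A i" "b \<in> A j" for i j a b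
      using that d1(2)[of a b] d1(2)[of b a] d2(2)[of a b] d2(2)[of b a]
      by (auto simp: A_def dist_commute min_le_iff_disj split: if_splits)
  qed (use B e t d1 d2 in \<open>auto simp: A_def F_def S_def intro: subsetD[OF sheet_over_subset_frontier]\<close>)
  moreover have "ennreal (2 * unit_ball_vol n * r ^ n) < ennreal (\<Sum>i\<in>{0,1,2}. unit_ball_vol n * S i ^ n)"
  proof (rule ennreal_lessI)
    have w: "0 < unit_ball_vol n" by simp
    have "unit_ball_vol n * (2 * r ^ n) < unit_ball_vol n * (t ^ n + (t ^ n + s ^ n))"
      using t(1) by (intro mult_strict_left_mono w) simp
    also have "\<dots> = (\<Sum>i\<in>{0,1,2}. unit_ball_vol n * S i ^ n)" by (simp add: S_def algebra_simps)
    finally show "2 * unit_ball_vol n * r ^ n < (\<Sum>i\<in>{0,1,2}. unit_ball_vol n * S i ^ n)" by (simp add: mult_ac)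
    then show "0 < (\<Sum>i\<in>{0,1,2}. unit_ball_vol n * S i ^ n)"
      using w r by (smt (verit) mult_pos_pos zero_less_power)
  qed
  ultimately show ?thesis by simp
qed

lemma opposite_sheetsE:
  assumes "a \<in> sheet_over K e x r \<union> sheet_over K (- e) x r"
  obtains u t where "u \<bullet> e = 0" "norm u \<le> r" "a = x + u + t *\<^sub>R e"
  using assms
proof
  assume "a \<in> sheet_over K (- e) x r"
  then obtain u t where "u \<bullet> - e = 0" "norm u \<le> r" "a = x + u + t *\<^sub>R (- e)" by (rule sheet_overE)
  then show thesis using that[of u "- t"] by simp
qed (use that in \<open>auto simp: sheet_over_def\<close>)

text \<open>
  The projection contains the \<open>r\<close>-ball about \<open>x\<close> and a point at distance \<open>s > r\<close>, hence also the ball that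
  results from shrinking the \<open>r\<close>-ball towards that point by the factor \<open>l\<close>. For \<open>l = (s - r) / (s + r)\<close> it
  touches the \<open>r\<close>-ball from outside. The upper sheet over it is the third piece.
\<close>

lemma hausdorff_measure_gt_if_wide:
  fixes K :: "'a::euclidean_space set"
  assumes dim: "DIM('a) = n + 1"
    and K: "compact K" "convex K" "interior K \<noteq> {}"
    and e: "norm e = 1" and v: "norm v = 1" "v \<bullet> e = 0"
    and sh: "shadows_ball K e x r" and r: "0 < r"
    and wide: "r < s" "x + s *\<^sub>R v + t *\<^sub>R e \<in> K"
  shows "ennreal (2 * unit_ball_vol n * r ^ n) < hausdorff_measure n (frontier K)"
proof -
  define l where "l = (s - r) / (s + r)"
  have "l * (s + r) = s - r" using r wide by (simp add: l_def)
  then have "s - l * s - l * r = r" by (simp add: algebra_simps)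
  moreover have "0 < l" "l < 1" using r wide by (simp_all add: l_def divide_less_eq)
  ultimately have l: "0 < l" "l < 1" "s - l * s - l * r = r" by auto
  define c where "c = x + ((1 - l) * s) *\<^sub>R v"
  have e0: "e \<noteq> 0" using e by auto
  have shc: "shadows_ball K e c (l * r)" unfolding shadows_ball_def
  proof (intro allI impI)
    fix u assume u: "u \<bullet> e = 0 \<and> norm u \<le> l * r"
    then have "norm ((1 / l) *\<^sub>R u) \<le> r" "(1 / l) *\<^sub>R u \<bullet> e = 0" using l(1) by (simp_all add: field_simps)
    then obtain \<tau> where "x + (1 / l) *\<^sub>R u + \<tau> *\<^sub>R e \<in> K" using shadows_ballE[OF sh] by blast
    then have "l *\<^sub>R (x + (1 / l) *\<^sub>R u + \<tau> *\<^sub>R e) + (1 - l) *\<^sub>R (x + s *\<^sub>R v + t *\<^sub>R e) \<in> K"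
      using convexD[OF K(2) _ wide(2), of _ l "1 - l"] l by simp
    also have "l *\<^sub>R (x + (1 / l) *\<^sub>R u + \<tau> *\<^sub>R e) + (1 - l) *\<^sub>R (x + s *\<^sub>R v + t *\<^sub>R e)
        = c + u + (l * \<tau> + (1 - l) * t) *\<^sub>R e"
      using l(1) by (simp add: c_def algebra_simps)
    finally show "\<exists>\<tau>. c + u + \<tau> *\<^sub>R e \<in> K" by blast
  qed
  show ?thesis
  proof (rule hausdorff_measure_gt_two_balls[OF dim K e sh r sheet_over_subset_frontier e _
        shadows_ball_sheet_over[OF K(1) e0 shc]])
    fix r' assume r': "0 < r'" "r' < r"
    have "r - r' \<le> dist a b"
      if a: "a \<in> sheet_over K e x r' \<union> sheet_over K (- e) x r'" and b: "b \<in> sheet_over K e c (l * r)" for a b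
    proof -
      obtain u \<alpha> where u: "u \<bullet> e = 0" "norm u \<le> r'" "a = x + u + \<alpha> *\<^sub>R e" using a by (rule opposite_sheetsE)
      obtain w \<beta> where w: "w \<bullet> e = 0" "norm w \<le> l * r" "b = c + w + \<beta> *\<^sub>R e" using b by (rule sheet_overE)
      define z where "z = ((1 - l) * s) *\<^sub>R v + (w - u)"
      have z: "z \<bullet> e = 0" "b - a = z + (\<beta> - \<alpha>) *\<^sub>R e"
        using u w v by (simp_all add: z_def c_def algebra_simps)
      have "(1 - l) * s = norm (((1 - l) * s) *\<^sub>R v)" using l r wide v by simp
      also have "\<dots> = norm (z - w + u)" by (simp add: z_def)
      also have "\<dots> \<le> norm z + norm w + norm u"
        using norm_triangle_ineq[of "z - w" u] norm_triangle_ineq4[of z w] by linarith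
      finally have "r - r' \<le> norm z" using u(2) w(2) l(3) by (simp add: algebra_simps)
      also have "\<dots> \<le> norm (b - a)" unfolding z(2) by (rule norm_orthogonal_add_ge[OF e z(1)])
      finally show ?thesis by (simp add: dist_norm norm_minus_commute)
    qed
    then show "\<exists>\<delta>>0. \<forall>a \<in> sheet_over K e x r' \<union> sheet_over K (- e) x r'. \<forall>b \<in> sheet_over K e c (l * r). \<delta> \<le> dist a b"
      using r' by (intro exI[of _ "r - r'"]) auto
  qed (use l r in simp)
qed

text \<open>
  \<open>K\<close> need not equal the cylinder, but over the base of the cylinder its upper sheet lies at height at
  least \<open>h\<close> and its lower sheet at height at most 0. The third piece is the part of the boundary at heights between \<open>h / 3\<close> and \<open>2 h / 3\<close>; it is projected along
  a direction \<open>f\<close> orthogonal to the axis, and this projection contains a ball about the midpoint of the axis.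
\<close>

lemma hausdorff_measure_gt_if_cylinder:
  fixes K :: "'a::euclidean_space set"
  assumes dim: "DIM('a) = n + 1"
    and K: "compact K" "convex K" "interior K \<noteq> {}"
    and e: "norm e = 1" and f: "norm f = 1" "f \<bullet> e = 0" and h: "0 < h" and r: "0 < r"
    and cyl: "\<And>u t. u \<bullet> e = 0 \<Longrightarrow> norm u \<le> r \<Longrightarrow> 0 \<le> t \<Longrightarrow> t \<le> h \<Longrightarrow> x + u + t *\<^sub>R e \<in> K"
  shows "ennreal (2 * unit_ball_vol n * r ^ n) < hausdorff_measure n (frontier K)"
proof -
  have ee: "e \<bullet> e = 1" using e by (simp add: norm_eq_1)
  have sh: "shadows_ball K e x r" unfolding shadows_ball_def using cyl[of _ 0] h by (metis less_imp_le order_refl)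
  define B where "B = {z \<in> frontier K. h / 3 \<le> (z - x) \<bullet> e \<and> (z - x) \<bullet> e \<le> 2 * h / 3}"
  define c where "c = x + (h / 2) *\<^sub>R e"
  define s where "s = min r (h / 6)"
  have shB: "shadows_ball B f c s" unfolding shadows_ball_def
  proof (intro allI impI)
    fix u assume u: "u \<bullet> f = 0 \<and> norm u \<le> s"
    define t where "t = u \<bullet> e"
    define w where "w = u - t *\<^sub>R e"
    have w: "w \<bullet> e = 0" "u = w + t *\<^sub>R e" by (simp_all add: w_def t_def inner_diff_left ee)
    have "norm w \<le> s" "\<bar>t\<bar> \<le> s" using norm_orthogonal_add_ge[OF e w(1), of t] u w(2) by auto
    then have wt: "norm w \<le> r" "0 \<le> h / 2 + t" "h / 2 + t \<le> h" "\<bar>t\<bar> \<le> h / 6" using h by (auto simp: s_def)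
    have "x + w + (h / 2 + t) *\<^sub>R e \<in> K" using cyl[OF w(1) wt(1,2,3)] .
    also have "x + w + (h / 2 + t) *\<^sub>R e = c + u" by (simp add: c_def w(2) algebra_simps)
    finally have "c + u \<in> K" .
    moreover have "f \<noteq> 0" using f(1) by auto
    ultimately obtain \<tau> where "c + u + \<tau> *\<^sub>R f \<in> sheet K f" using ray_exits_through_sheet[OF K(1)] by blast
    then have "c + u + \<tau> *\<^sub>R f \<in> frontier K" using sheet_subset_frontier by blast
    moreover have "(c + u + \<tau> *\<^sub>R f - x) \<bullet> e = h / 2 + t"
      using f(2) w(1) by (simp add: c_def inner_add_left inner_diff_left ee t_def)
    ultimately have "c + u + \<tau> *\<^sub>R f \<in> B" using wt(4) by (auto simp: B_def)
    then show "\<exists>\<tau>. c + u + \<tau> *\<^sub>R f \<in> B" by blast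
  qed
  show ?thesis
  proof (rule hausdorff_measure_gt_two_balls[OF dim K e sh r _ f(1) _ shB])
    fix r' assume r': "0 < r'" "r' < r"
    have up: "h \<le> (a - x) \<bullet> e" if a: "a \<in> sheet_over K e x r'" for a
    proof (rule ccontr)
      assume lt: "\<not> ?thesis"
      obtain u t where u: "u \<bullet> e = 0" "norm u \<le> r'" "a = x + u + t *\<^sub>R e" and top: "\<forall>\<tau>>0. a + \<tau> *\<^sub>R e \<notin> K"
        using a by (rule sheet_overE)
      have "0 < h - t" using lt u(1) by (simp add: u(3) inner_add_left ee)
      with top have "a + (h - t) *\<^sub>R e \<notin> K" by blast
      also have "a + (h - t) *\<^sub>R e = x + u + h *\<^sub>R e" by (simp add: u(3) algebra_simps)
      finally show False using cyl[OF u(1), of h] u(2) r' h by simp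
    qed
    have down: "(a - x) \<bullet> e \<le> 0" if a: "a \<in> sheet_over K (- e) x r'" for a
    proof (rule ccontr)
      assume lt: "\<not> ?thesis"
      obtain u t where u: "u \<bullet> - e = 0" "norm u \<le> r'" "a = x + u + t *\<^sub>R (- e)" and top: "\<forall>\<tau>>0. a + \<tau> *\<^sub>R (- e) \<notin> K"
        using a by (rule sheet_overE)
      have "0 < - t" using lt u(1) by (simp add: u(3) inner_diff_left ee)
      with top have "a + (- t) *\<^sub>R (- e) \<notin> K" by blast
      also have "a + (- t) *\<^sub>R (- e) = x + u + 0 *\<^sub>R e" by (simp add: u(3))
      finally show False using cyl[of u 0] u(1,2) r' h by simp
    qed
    have "h / 3 \<le> dist a b" if a: "a \<in> sheet_over K e x r' \<union> sheet_over K (- e) x r'" and b: "b \<in> B" for a b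
    proof -
      have "\<bar>(a - x) \<bullet> e - (b - x) \<bullet> e\<bar> \<le> dist a b"
        using Cauchy_Schwarz_ineq2[of "a - b" e] e by (simp add: dist_norm inner_diff_left)
      then show ?thesis using a b up[of a] down[of a] by (auto simp: B_def)
    qed
    then show "\<exists>\<delta>>0. \<forall>a \<in> sheet_over K e x r' \<union> sheet_over K (- e) x r'. \<forall>b \<in> B. \<delta> \<le> dist a b"
      using h by (intro exI[of _ "h / 3"]) auto
  qed (use h r in \<open>auto simp: B_def s_def\<close>)
qed

section \<open>Convex bodies between two parallel support planes\<close>

text \<open>
  A boundary point on the wrong side could be joined to \<open>y\<close> by a segment that crosses the hyperplane
  strictly between its end points. But \<open>y\<close> lies strictly on the admissible side of the support plane, so
  such a segment cannot reach it. The whole body follows since it is the convex hull of its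
  boundary.
\<close>

lemma convex_body_in_supporting_halfspace:
  fixes K :: "'a::euclidean_space set"
  assumes K: "compact K" "convex K" and y: "y \<in> frontier K" "x \<noteq> y"
    and sup: "support_plane (orth_hyperplane x y) (frontier K)" and z: "z \<in> K"
  shows "0 \<le> (z - x) \<bullet> (y - x)"
proof -
  obtain a b where H: "orth_hyperplane x y = {z. a \<bullet> z = b}" and le: "frontier K \<subseteq> {z. a \<bullet> z \<le> b}"
    using sup unfolding support_plane_def by blast
  have plane: "a \<bullet> w = b \<longleftrightarrow> (w - x) \<bullet> (y - x) = 0" for w
    using H by (auto simp: orth_hyperplane_def set_eq_iff inner_commute)
  have pos: "0 < (y - x) \<bullet> (y - x)" using y(2) by simp
  then have "a \<bullet> y < b" using plane[of y] le y(1) by (force simp: less_le)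
  have "frontier K \<subseteq> {w. 0 \<le> (w - x) \<bullet> (y - x)}"
  proof (rule subsetI, rule CollectI, rule ccontr)
    fix w assume w: "w \<in> frontier K" and neg: "\<not> 0 \<le> (w - x) \<bullet> (y - x)"
    define p where "p = (w - x) \<bullet> (y - x)"
    define d where "d = (y - x) \<bullet> (y - x) - p"
    define s where "s = - p / d"
    have d: "0 < d" "p < 0" using neg pos unfolding p_def d_def by linarith+
    have "- p < 1 * d" using pos by (simp add: d_def)
    then have s: "0 < s" "s < 1" using divide_pos_pos[of "- p" d] d
      by (simp_all only: s_def pos_divide_less_eq neg_0_less_iff_less)
    define q where "q = (1 - s) *\<^sub>R w + s *\<^sub>R y"
    have "q - x = (1 - s) *\<^sub>R (w - x) + s *\<^sub>R (y - x)" by (simp add: q_def algebra_simps)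
    then have "(q - x) \<bullet> (y - x) = (1 - s) * p + s * ((y - x) \<bullet> (y - x))"
      by (simp only: inner_add_left inner_scaleR_left p_def)
    also have "\<dots> = p + s * d" by (simp add: d_def right_diff_distrib left_diff_distrib)
    also have "\<dots> = 0" using d by (simp add: s_def)
    finally have "a \<bullet> q = b" by (simp add: plane)
    moreover have "(1 - s) * (a \<bullet> w) \<le> (1 - s) * b" using le w s by (intro mult_left_mono) auto
    moreover have "s * (a \<bullet> y) < s * b" using \<open>a \<bullet> y < b\<close> s by (intro mult_strict_left_mono)
    ultimately show False by (simp add: q_def inner_add_right algebra_simps)
  qed
  moreover have "convex {w. 0 \<le> (w - x) \<bullet> (y - x)}"
  proof -
    have "{w. 0 \<le> (w - x) \<bullet> (y - x)} = {w. (y - x) \<bullet> w \<ge> (y - x) \<bullet> x}"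
      by (auto simp: inner_diff_left inner_commute)
    then show ?thesis by (simp add: convex_halfspace_ge)
  qed
  ultimately have "convex hull (frontier K) \<subseteq> {w. 0 \<le> (w - x) \<bullet> (y - x)}" by (rule hull_minimal)
  then show ?thesis using z Krein_Milman_frontier[OF K(2,1)] by auto
qed

lemma cylinder_in_convex_body:
  fixes K :: "'a::real_inner set"
  assumes K: "convex K" and r: "0 < r" and h: "0 < h"
    and xy: "x \<in> K" "x + h *\<^sub>R e \<in> K"
    and rims: "\<And>v. norm v = 1 \<Longrightarrow> v \<bullet> e = 0 \<Longrightarrow> x + r *\<^sub>R v \<in> K \<and> x + r *\<^sub>R v + h *\<^sub>R e \<in> K"
    and u: "u \<bullet> e = 0" "norm u \<le> r" and t: "0 \<le> t" "t \<le> h"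
  shows "x + u + t *\<^sub>R e \<in> K"
proof -
  have vertical: "w + t *\<^sub>R e \<in> K" if "w \<in> K" "w + h *\<^sub>R e \<in> K" for w
  proof -
    have "(1 - t / h) *\<^sub>R w + (t / h) *\<^sub>R (w + h *\<^sub>R e) \<in> K"
      using convexD[OF K that, of "1 - t / h" "t / h"] t h by simp
    then show ?thesis using h by (simp add: algebra_simps)
  qed
  show ?thesis
  proof (cases "u = 0")
    case True
    then show ?thesis using vertical[OF xy] by simp
  next
    case False
    define v where "v = (1 / norm u) *\<^sub>R u"
    define l where "l = norm u / r"
    have v: "norm v = 1" "v \<bullet> e = 0" "u = l *\<^sub>R (r *\<^sub>R v)" using False u r by (simp_all add: v_def l_def)
    have "x + t *\<^sub>R e \<in> K" "x + r *\<^sub>R v + t *\<^sub>R e \<in> K" using vertical xy rims[OF v(1,2)] by auto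
    then have "(1 - l) *\<^sub>R (x + t *\<^sub>R e) + l *\<^sub>R (x + r *\<^sub>R v + t *\<^sub>R e) \<in> K"
      using convexD[OF K, of _ _ "1 - l" l] u(2) r by (simp add: l_def)
    then show ?thesis by (simp add: v(3) algebra_simps)
  qed
qed

lemma shadow_contains_ball:
  fixes K :: "'a::real_inner set"
  assumes K: "convex K" and r: "0 < r" and x: "x \<in> K"
    and radius: "\<And>v. norm v = 1 \<Longrightarrow> v \<bullet> e = 0 \<Longrightarrow> \<exists>s\<ge>r. \<exists>t. x + s *\<^sub>R v + t *\<^sub>R e \<in> K"
    and u: "u \<bullet> e = 0" "norm u \<le> r"
  shows "\<exists>t. x + u + t *\<^sub>R e \<in> K"
proof (cases "u = 0")
  case True
  then show ?thesis using x by (auto intro: exI[of _ 0])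
next
  case False
  define v where "v = (1 / norm u) *\<^sub>R u"
  have v: "norm v = 1" "v \<bullet> e = 0" using False u by (simp_all add: v_def)
  from radius[OF this] obtain s t where st: "r \<le> s" "x + s *\<^sub>R v + t *\<^sub>R e \<in> K" by blast
  define l where "l = norm u / s"
  have l: "0 \<le> l" "l \<le> 1" "u = l *\<^sub>R (s *\<^sub>R v)" using False u r st(1) by (simp_all add: l_def v_def)
  have "(1 - l) *\<^sub>R x + l *\<^sub>R (x + s *\<^sub>R v + t *\<^sub>R e) \<in> K"
    using convexD[OF K x st(2), of "1 - l" l] l by simp
  also have "(1 - l) *\<^sub>R x + l *\<^sub>R (x + s *\<^sub>R v + t *\<^sub>R e) = x + u + (l * t) *\<^sub>R e"
    by (simp add: l(3) algebra_simps)
  finally show ?thesis by blast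
qed

text \<open>
  From \<open>h \<le> d / \<rho>\<close> one gets \<open>(\<rho> - 1) / \<rho> * d \<le> d - h\<close>; the denominator of the constant
  combines the halved radius with the factor 2 for the two sheets.
\<close>

lemma I_star_times_power_le:
  assumes n: "1 \<le> n" and rho: "1 < \<rho>" and d: "\<rho> * h \<le> d" and h: "0 < h"
  shows "I_star n \<rho> * d ^ n \<le> 2 * unit_ball_vol n * ((d - h) / 2) ^ n"
proof -
  have "0 < d" using mult_pos_pos[of \<rho> h] rho h d by linarith
  have "(\<rho> - 1) / \<rho> * d \<le> d - h" using rho d by (simp add: field_simps)
  then have "((\<rho> - 1) / \<rho> * d) ^ n \<le> (d - h) ^ n" using rho \<open>0 < d\<close> by (intro power_mono) auto
  then have "unit_ball_vol n / 2 ^ (n - 1) * ((\<rho> - 1) / \<rho> * d) ^ n \<le> unit_ball_vol n / 2 ^ (n - 1) * (d - h) ^ n"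
    by (intro mult_left_mono) auto
  moreover have "I_star n \<rho> * d ^ n = unit_ball_vol n / 2 ^ (n - 1) * ((\<rho> - 1) / \<rho> * d) ^ n"
    unfolding I_star_def power_mult_distrib by (rule mult.assoc)
  moreover have "unit_ball_vol n / 2 ^ (n - 1) * (d - h) ^ n = 2 * unit_ball_vol n * ((d - h) / 2) ^ n"
    using n by (cases n) (simp_all add: power_divide)
  ultimately show ?thesis by simp
qed

theorem corollary2p10:
  fixes M :: "'a::euclidean_space set" and x y :: 'a and n :: nat and \<rho> :: real
  assumes "n \<ge> 1" and "DIM('a) = n + 1"
    and "closed_convex_hypersurface M"
    and "\<rho> > 1"
    and "x \<in> M" and "y \<in> M" and "x \<noteq> y"
    and "intrinsic_dist M x y / ennreal (norm (y - x)) \<ge> ennreal \<rho>"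
    and "support_plane (orth_hyperplane x y) M"
    and "support_plane (orth_hyperplane y x) M"
  shows "hausdorff_measure n M > ennreal (I_star n \<rho>) * intrinsic_dist M x y ^ n"
proof -
  obtain K where K: "compact K" "convex K" "interior K \<noteq> {}" and M: "M = frontier K"
    using assms(3) unfolding closed_convex_hypersurface_def by blast
  have clK: "closed K" using K(1) by (rule compact_imp_closed)
  define h where "h = norm (y - x)"
  define e where "e = (1 / h) *\<^sub>R (y - x)"
  have h: "0 < h" using assms(7) by (simp add: h_def)
  have e: "norm e = 1" "y = x + h *\<^sub>R e" using h by (simp_all add: e_def h_def)
  have ee: "e \<bullet> e = 1" using e(1) by (simp add: norm_eq_1)
  have xK: "x \<in> K" "x + h *\<^sub>R e \<in> K"
    using assms(5,6) clK frontier_subset_closed unfolding M e(2) by blast+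
  have slab1: "0 \<le> (z - x) \<bullet> e" if "z \<in> K" for z
    using convex_body_in_supporting_halfspace[OF K(1,2) _ _ _ that, of y x] assms(6,7,9) h
    by (simp add: M e(2) zero_le_mult_iff)
  have slab2: "(z - x) \<bullet> e \<le> h" if "z \<in> K" for z
  proof -
    have "0 \<le> (z - y) \<bullet> (x - y)"
      using convex_body_in_supporting_halfspace[OF K(1,2) _ _ _ that, of x y] assms(5,7,10) by (simp add: M)
    also have "(z - y) \<bullet> (x - y) = h * (h - (z - x) \<bullet> e)"
      by (simp add: e(2) inner_diff_left inner_add_left ee algebra_simps)
    finally show ?thesis using h by (simp add: zero_le_mult_iff)
  qed
  obtain f0 where f0: "f0 \<noteq> 0" "orthogonal e f0"
    using orthogonal_to_vector_exists[of e] assms(1,2) by auto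
  define f where "f = (1 / norm f0) *\<^sub>R f0"
  have f: "norm f = 1" "f \<bullet> e = 0" using f0 by (simp_all add: f_def orthogonal_def inner_commute)
  have short: "intrinsic_dist M x y < ennreal (2 * r + h)"
    if v: "norm v = 1" "v \<bullet> e = 0" and r: "0 < r" "\<And>s t. x + s *\<^sub>R v + t *\<^sub>R e \<in> K \<Longrightarrow> s \<le> r"
      and corner: "x + r *\<^sub>R v \<notin> K \<or> x + r *\<^sub>R v + h *\<^sub>R e \<notin> K" for v r
    using intrinsic_dist_less_rectangle[OF clK K(2,3) e(1) v h xK slab1 slab2 r(2,1) corner]
    unfolding M e(2) .
  \<comment> \<open>Finiteness of the intrinsic distance: a rectangle wide enough to have its corners
    outside \<open>K\<close>.\<close>
  obtain b where b: "0 < b" "\<And>z. z \<in> K \<Longrightarrow> norm (z - x) \<le> b"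
  proof -
    obtain b where "\<And>z. z \<in> K \<Longrightarrow> norm z \<le> b" using compact_imp_bounded[OF K(1)] by (auto simp: bounded_iff)
    then have "norm (z - x) \<le> \<bar>b\<bar> + norm x + 1" if "z \<in> K" for z
      using norm_triangle_ineq4[of z x] that by force
    then show thesis using that[of "\<bar>b\<bar> + norm x + 1"] by (simp add: add_nonneg_pos)
  qed
  have far: "s \<le> b" if "x + s *\<^sub>R f + t *\<^sub>R e \<in> K" for s t
  proof -
    have "\<bar>s\<bar> = norm (s *\<^sub>R f)" using f(1) by simp
    also have "\<dots> \<le> norm (s *\<^sub>R f + t *\<^sub>R e)" using f(2) by (intro norm_orthogonal_add_ge e(1)) simp
    also have "\<dots> \<le> b" using b(2)[OF that] by (simp add: add.assoc)
    finally show ?thesis by simp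
  qed
  have "intrinsic_dist M x y < ennreal (2 * (b + 1) + h)"
  proof (rule short[OF f])
    show "s \<le> b + 1" if "x + s *\<^sub>R f + t *\<^sub>R e \<in> K" for s t using far[OF that] by simp
    show "x + (b + 1) *\<^sub>R f \<notin> K \<or> x + (b + 1) *\<^sub>R f + h *\<^sub>R e \<notin> K" using far[of "b + 1" h] by force
  qed (use b(1) in simp)
  then have "intrinsic_dist M x y \<noteq> top" by (auto simp: less_top[symmetric])
  then obtain d where d: "intrinsic_dist M x y = ennreal d" "0 \<le> d" by (cases "intrinsic_dist M x y") auto
  have "ennreal \<rho> \<le> ennreal (d / h)" using assms(8) h d by (simp add: h_def[symmetric] divide_ennreal)
  then have "\<rho> \<le> d / h" using h d(2) by (subst (asm) ennreal_le_iff) auto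
  then have dh: "\<rho> * h \<le> d" using h by (simp add: pos_le_divide_eq)
  define r where "r = (d - h) / 2"
  have "1 * h < \<rho> * h" using assms(4) h by (intro mult_strict_right_mono)
  then have r: "0 < r" "2 * r + h = d" using dh unfolding r_def by (simp, argo)
  have dichotomy: "(\<exists>s>r. \<exists>t. x + s *\<^sub>R v + t *\<^sub>R e \<in> K) \<or> (x + r *\<^sub>R v \<in> K \<and> x + r *\<^sub>R v + h *\<^sub>R e \<in> K)"
    if v: "norm v = 1" "v \<bullet> e = 0" for v
  proof (rule ccontr)
    assume "\<not> ?thesis"
    then have "intrinsic_dist M x y < ennreal (2 * r + h)" by (intro short[OF v r(1)]) (auto simp: not_less[symmetric])
    then show False using d(1) r(2) by simp
  qed
  have "\<exists>s\<ge>r. \<exists>t. x + s *\<^sub>R v + t *\<^sub>R e \<in> K" if "norm v = 1" "v \<bullet> e = 0" for v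
    using dichotomy[OF that] by (meson less_imp_le order_refl)
  then have sh: "shadows_ball K e x r"
    unfolding shadows_ball_def using shadow_contains_ball[OF K(2) r(1) xK(1)] by blast
  have gt: "ennreal (2 * unit_ball_vol n * r ^ n) < hausdorff_measure n M"
  proof (cases "\<exists>v s t. norm v = 1 \<and> v \<bullet> e = 0 \<and> r < s \<and> x + s *\<^sub>R v + t *\<^sub>R e \<in> K")
    case True
    then show ?thesis
      unfolding M using hausdorff_measure_gt_if_wide[OF assms(2) K e(1) _ _ sh r(1)] by blast
  next
    case False
    then have "x + r *\<^sub>R v \<in> K \<and> x + r *\<^sub>R v + h *\<^sub>R e \<in> K" if "norm v = 1" "v \<bullet> e = 0" for v
      using dichotomy[OF that] that by blast
    then have "x + u + t *\<^sub>R e \<in> K" if "u \<bullet> e = 0" "norm u \<le> r" "0 \<le> t" "t \<le> h" for u t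
      using cylinder_in_convex_body[OF K(2) r(1) h xK _ that] by blast
    then show ?thesis unfolding M
      by (rule hausdorff_measure_gt_if_cylinder[OF assms(2) K e(1) f h r(1)])
  qed
  have "0 \<le> I_star n \<rho>" using assms(4) by (simp add: I_star_def)
  then have "ennreal (I_star n \<rho>) * intrinsic_dist M x y ^ n = ennreal (I_star n \<rho> * d ^ n)"
    using d by (simp add: ennreal_power ennreal_mult)
  also have "\<dots> \<le> ennreal (2 * unit_ball_vol n * r ^ n)"
    unfolding r_def by (intro ennreal_leI I_star_times_power_le assms(1,4) dh h)
  finally show ?thesis using gt by (rule order.strict_trans1)
qed

end
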